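(* Let $H$ be a digraph with $h$ vertices, $m$ arcs, maximum out-degree $\Delta$, and exactly $k_1$ vertices of in-degree zero, such that $\delta(H)\ge 1$, and set $q=\Delta\cdot\max\{h/2,m\}$. Then every $(k_1+m+1)$-connected semicomplete digraph $D$ with $\delta^+(D)\ge 10^7q^4$ is $H$-linked.
   Context: All digraphs are finite and simple. $\delta(H)=\min\{d^+_H(v)+d^-_H(v): v\in V(H)\}$, so $\delta(H)\ge1$ means $H$ has no isolated vertices. A semicomplete digraph is a digraph in which every pair of distinct vertices is joined by at least one arc. A digraph is $t$-connected if it has at least $t+1$ vertices and, for every set $S$ of at most $t-1$ vertices and any distinct $x,y\notin S$, there is a directed $(x,y)$-path in $D-S$. $\delta^+(D)$ is the minimum out-degree of $D$. An $H$-subdivision $(f,g)$ in $D$ consists of an injective map $f:V(H)\to V(D)$ and a map $g$ assigning to every arc $uv\in A(H)$ a directed path $g(uv)$ in $D$ from $f(u)$ to $f(v)$, such that the paths assigned to distinct arcs are internally vertex-disjoint and have no internal vertices in $f(V(H))$. $D$ is $H$-linked if every injective map $f:V(H)\to V(D)$ can be extended to an $H$-subdivision $(f,g)$ in $D$. *)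

theory Defs
  imports Complex_Main
begin

definition simple_digraph :: "'a set \<Rightarrow> ('a \<times> 'a) set \<Rightarrow> bool" where
  "simple_digraph V A \<longleftrightarrow> finite V \<and> A \<subseteq> V \<times> V \<and> (\<forall>v. (v, v) \<notin> A)"

definition outdeg :: "('a \<times> 'a) set \<Rightarrow> 'a \<Rightarrow> nat" where
  "outdeg A v = card {w. (v, w) \<in> A}"

definition indeg :: "('a \<times> 'a) set \<Rightarrow> 'a \<Rightarrow> nat" where
  "indeg A v = card {u. (u, v) \<in> A}"

definition min_total_degree_ge1 :: "'a set \<Rightarrow> ('a \<times> 'a) set \<Rightarrow> bool" where
  "min_total_degree_ge1 V A \<longleftrightarrow> (\<forall>v\<in>V. outdeg A v + indeg A v \<ge> 1)"

definition max_outdeg :: "'a set \<Rightarrow> ('a \<times> 'a) set \<Rightarrow> nat" where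
  "max_outdeg V A = Max (outdeg A ` V)"

definition min_outdeg :: "'a set \<Rightarrow> ('a \<times> 'a) set \<Rightarrow> nat" where
  "min_outdeg V A = Min (outdeg A ` V)"

definition num_sources :: "'a set \<Rightarrow> ('a \<times> 'a) set \<Rightarrow> nat" where
  "num_sources V A = card {v \<in> V. indeg A v = 0}"

definition semicomplete :: "'a set \<Rightarrow> ('a \<times> 'a) set \<Rightarrow> bool" where
  "semicomplete V A \<longleftrightarrow> simple_digraph V A \<and>
     (\<forall>x\<in>V. \<forall>y\<in>V. x \<noteq> y \<longrightarrow> (x, y) \<in> A \<or> (y, x) \<in> A)"

definition dpath :: "'a set \<Rightarrow> ('a \<times> 'a) set \<Rightarrow> 'a list \<Rightarrow> 'a \<Rightarrow> 'a \<Rightarrow> bool" where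
  "dpath V A p x y \<longleftrightarrow> p \<noteq> [] \<and> distinct p \<and> set p \<subseteq> V \<and> hd p = x \<and> last p = y \<and>
     (\<forall>i. Suc i < length p \<longrightarrow> (p ! i, p ! Suc i) \<in> A)"

definition internal :: "'a list \<Rightarrow> 'a set" where
  "internal p = set (butlast (tl p))"

definition t_connected :: "nat \<Rightarrow> 'a set \<Rightarrow> ('a \<times> 'a) set \<Rightarrow> bool" where
  "t_connected t V A \<longleftrightarrow> card V \<ge> t + 1 \<and>
     (\<forall>S. S \<subseteq> V \<longrightarrow> card S \<le> t - 1 \<longrightarrow>
        (\<forall>x\<in>V - S. \<forall>y\<in>V - S. x \<noteq> y \<longrightarrow> (\<exists>p. dpath V A p x y \<and> set p \<inter> S = {})))"

definition is_subdivision ::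
  "'b set \<Rightarrow> ('b \<times> 'b) set \<Rightarrow> 'a set \<Rightarrow> ('a \<times> 'a) set \<Rightarrow> ('b \<Rightarrow> 'a) \<Rightarrow> ('b \<times> 'b \<Rightarrow> 'a list) \<Rightarrow> bool" where
  "is_subdivision VH AH VD AD f g \<longleftrightarrow>
     inj_on f VH \<and> f ` VH \<subseteq> VD \<and>
     (\<forall>(u, v)\<in>AH. dpath VD AD (g (u, v)) (f u) (f v)) \<and>
     (\<forall>a\<in>AH. \<forall>b\<in>AH. a \<noteq> b \<longrightarrow> internal (g a) \<inter> internal (g b) = {}) \<and>
     (\<forall>a\<in>AH. internal (g a) \<inter> f ` VH = {})"

definition H_linked :: "'b set \<Rightarrow> ('b \<times> 'b) set \<Rightarrow> 'a set \<Rightarrow> ('a \<times> 'a) set \<Rightarrow> bool" where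
  "H_linked VH AH VD AD \<longleftrightarrow>
     (\<forall>f. inj_on f VH \<and> f ` VH \<subseteq> VD \<longrightarrow> (\<exists>g. is_subdivision VH AH VD AD f g))"

end

theory Submission
  imports Defs
begin

text \<open>
  Write $m$ for the number of arcs of $H$ and $M(v)$ for the set of vertices that do not send an arc
  to $v$. Take as hubs a set $X$ of $20m$ vertices with smallest $|M|$. All but few vertices send arcs
  to many hubs; the remaining "weak" ones form a set whose size is at most $10/9$ of the largest
  $|M(x)|$, $x \in X$. As $M$ is asymmetric and the out-degrees are large, every vertex leaves the weak
  set robustly after at most two steps inside it. The same argument, with $M(v)$ in place of the weak
  set, joins all ordered pairs of hubs by short disjoint routes.

  For every arc $uv$ of $H$ go from $f(u)$ through weak vertices to a vertex $z$ that dominates many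
  hubs. Then delete these vertices and link the hubs to the ends $f(v)$ by Menger's theorem.
  Connectivity allows the deletion of only one vertex, but if deleting a set $Y$ destroys the linkage,
  then two vertices of $Y$ lie in a common small separator with no arcs from its first side to its
  second side. In a semicomplete digraph such cuts are almost nested, so "lying in a common cut"
  behaves like the intersection graph of intervals of bounded depth: it is degenerate, and the
  vertices $z$ can be chosen pairwise conflict-free from large families. Since hubs are always on the
  first side, all but few weak vertices lie in no such separator.

  A linkage that prefers the arcs of the routes leaves all routes out of unused hubs untouched, and
  these complete the paths.
\<close>

subsection \<open>Counting\<close>

text \<open>The pairs in \<open>\<rho>\<close>, their converses and the diagonal cover
  \<open>Y \<times> Y\<close>, so its square size is at most
  \<open>card Y * (2 * t + 1)\<close>.\<close>

lemma card_le_of_total_relation: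
  assumes "finite Y"
    and out: "\<And>i. i \<in> Y \<Longrightarrow> card {j \<in> Y. \<rho> i j} \<le> t"
    and tot: "\<And>i j. i \<in> Y \<Longrightarrow> j \<in> Y \<Longrightarrow> i \<noteq> j \<Longrightarrow> \<rho> i j \<or> \<rho> j i"
  shows "card Y \<le> 2 * t + 1"
proof -
  let ?P = "SIGMA i:Y. {j \<in> Y. \<rho> i j}"
  have fin: "finite ?P" using assms(1) by auto
  have cP: "card ?P \<le> card Y * t"
    using sum_bounded_above[of Y "\<lambda>i. card {j \<in> Y. \<rho> i j}" t] out assms(1)
    by (simp add: card_SigmaI)
  have "Y \<times> Y \<subseteq> (?P \<union> ?P\<inverse>) \<union> (\<lambda>i. (i, i)) ` Y"
    using tot by auto
  then have "card (Y \<times> Y) \<le> card ((?P \<union> ?P\<inverse>) \<union> (\<lambda>i. (i, i)) ` Y)"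
    using fin assms(1) by (intro card_mono) auto
  also have "\<dots> \<le> card (?P \<union> ?P\<inverse>) + card ((\<lambda>i. (i, i)) ` Y)" by (rule card_Un_le)
  also have "\<dots> \<le> card ?P + card (?P\<inverse>) + card Y"
    using card_Un_le[of ?P "?P\<inverse>"] card_image_le[OF assms(1), of "\<lambda>i. (i, i)"] by linarith
  also have "\<dots> \<le> card Y * (2 * t + 1)"
    using cP by (simp add: algebra_simps)
  finally have "card Y * card Y \<le> card Y * (2 * t + 1)" by (simp add: card_cartesian_product)
  then show ?thesis by (metis le0 mult_le_cancel1 not_gr_zero)
qed

text \<open>By asymmetry, the pairs \<open>(v, w)\<close> with \<open>w \<in> M v\<close> and their
  converses are disjoint inside \<open>F \<times> F\<close>. Hence they fill at most half of it, and
  some \<open>v\<close> is no worse than the average.\<close>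

lemma asymmetric_small_degree:
  assumes "finite F" "F \<noteq> {}"
    and asym: "\<And>v w. v \<in> F \<Longrightarrow> w \<in> F \<Longrightarrow> w \<in> M v \<Longrightarrow> v \<notin> M w"
  shows "\<exists>v\<in>F. 2 * card (M v \<inter> F) \<le> card F"
proof (rule ccontr)
  assume "\<not> ?thesis"
  then have big: "card F < 2 * card (M v \<inter> F)" if "v \<in> F" for v using that by force
  let ?P = "SIGMA i:F. M i \<inter> F"
  have fin: "finite ?P" using assms(1) by auto
  have "?P \<inter> ?P\<inverse> = {}" using asym by auto
  then have "2 * card ?P = card (?P \<union> ?P\<inverse>)" using fin by (simp add: card_Un_disjoint)
  also have "\<dots> \<le> card (F \<times> F)" using assms(1) by (intro card_mono) auto
  finally have le: "2 * card ?P \<le> card F * card F" by (simp add: card_cartesian_product)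
  have "card F * card F = (\<Sum>i\<in>F. card F)" by simp
  also have "\<dots> < (\<Sum>i\<in>F. 2 * card (M i \<inter> F))"
    using assms(1,2) big by (intro sum_strict_mono) auto
  also have "\<dots> = 2 * card ?P" using assms(1) by (simp add: card_SigmaI sum_distrib_left)
  finally show False using le by linarith
qed

text \<open>Greedy choice by degeneracy: a vertex \<open>v\<close> of small degree in the union of
  all families represents one family containing it, and its closed neighbourhood is deleted from the
  others. Each round costs every remaining family at most \<open>\<kappa>\<close> elements, which
  the factor \<open>card I\<close> pays for.\<close>

lemma independent_transversal:
  assumes "finite I"
    and deg: "\<And>U. finite U \<Longrightarrow> U \<noteq> {} \<Longrightarrow> U \<subseteq> V \<Longrightarrow> \<exists>v\<in>U. card {w \<in> U. w = v \<or> \<rho> v w} \<le> \<kappa>"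
    and sym: "\<And>v w. \<rho> v w \<Longrightarrow> \<rho> w v"
    and fam: "\<And>e. e \<in> I \<Longrightarrow> finite (F e) \<and> F e \<subseteq> V \<and> card I * \<kappa> \<le> card (F e) \<and> F e \<noteq> {}"
  shows "\<exists>z. (\<forall>e\<in>I. z e \<in> F e) \<and> (\<forall>e\<in>I. \<forall>e'\<in>I. e \<noteq> e' \<longrightarrow> z e \<noteq> z e' \<and> \<not> \<rho> (z e) (z e'))"
  using assms(1) fam
proof (induction "card I" arbitrary: I F)
  case 0
  then show ?case by auto
next
  case (Suc n)
  let ?U = "\<Union>e\<in>I. F e"
  have "I \<noteq> {}" using Suc.hyps(2) by auto
  then have "finite ?U" "?U \<noteq> {}" "?U \<subseteq> V" using Suc.prems by blast+
  then obtain v where v: "v \<in> ?U" and cv: "card {w \<in> ?U. w = v \<or> \<rho> v w} \<le> \<kappa>" using deg by metis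
  let ?N = "{w \<in> ?U. w = v \<or> \<rho> v w}"
  obtain e0 where e0: "e0 \<in> I" "v \<in> F e0" using v by auto
  let ?I = "I - {e0}" and ?F = "\<lambda>e. F e - ?N"
  have n: "n = card ?I" using Suc.hyps(2) Suc.prems(1) e0 by simp
  have finN: "finite ?N" by (rule finite_subset[OF _ \<open>finite ?U\<close>]) blast
  \<comment> \<open>\<open>v\<close> counts itself, so \<open>\<kappa>\<close> is positive; the size
    bound then also keeps the reduced families nonempty.\<close>
  have "v \<in> ?N" using v by auto
  then have "card ?N \<noteq> 0" using finN by auto
  then have kpos: "0 < \<kappa>" using cv by linarith
  have fam': "finite (?F e) \<and> ?F e \<subseteq> V \<and> card ?I * \<kappa> \<le> card (?F e) \<and> ?F e \<noteq> {}" if "e \<in> ?I" for e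
  proof -
    have e: "e \<in> I" using that by auto
    have "card (F e) - card ?N \<le> card (?F e)" using finN by (rule diff_card_le_card_Diff)
    moreover have "Suc n * \<kappa> \<le> card (F e)" using Suc.prems(2)[OF e] Suc.hyps(2) by simp
    ultimately have *: "n * \<kappa> \<le> card (?F e)" using cv by simp
    have "n \<noteq> 0" using n that Suc.prems(1) by auto
    then have "0 < n * \<kappa>" using kpos by simp
    then have "card (?F e) \<noteq> 0" using * by linarith
    then have "?F e \<noteq> {}" by (metis card.empty)
    then show ?thesis using Suc.prems(2)[OF e] * n by auto
  qed
  obtain z where z: "\<And>e. e \<in> ?I \<Longrightarrow> z e \<in> ?F e"
    "\<And>e e'. e \<in> ?I \<Longrightarrow> e' \<in> ?I \<Longrightarrow> e \<noteq> e' \<Longrightarrow> z e \<noteq> z e' \<and> \<not> \<rho> (z e) (z e')"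
    using Suc.hyps(1)[of ?I ?F, OF n _ fam'] Suc.prems(1) by (metis (no_types, lifting) finite_Diff)
  have far: "z e \<noteq> v" "\<not> \<rho> v (z e)" "\<not> \<rho> (z e) v" if "e \<in> ?I" for e
    using z(1)[OF that] that sym by auto
  show ?case
    by (rule exI[of _ "z(e0 := v)"]) (use e0 z far in \<open>auto\<close>)
qed

subsection \<open>Menger's theorem\<close>

text \<open>Encoded by a closed side \<open>U\<close> instead of by paths: arcs leave
  \<open>U\<close> only into \<open>C\<close>. Sides of two separators can then be intersected and
  united directly, which is all that the induction for Menger's theorem needs. \<open>C\<close> may
  meet \<open>A\<close> and \<open>B\<close>.\<close>

definition separates :: "('c \<times> 'c) set \<Rightarrow> 'c set \<Rightarrow> 'c set \<Rightarrow> 'c set \<Rightarrow> bool" where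
  "separates E A B C \<longleftrightarrow>
     (\<exists>U. A \<subseteq> U \<union> C \<and> U \<inter> C = {} \<and> U \<inter> B = {} \<and> E `` U \<subseteq> U \<union> C)"

definition path_between :: "('c \<times> 'c) set \<Rightarrow> 'c set \<Rightarrow> 'c \<Rightarrow> 'c list \<Rightarrow> bool" where
  "path_between E A b p \<longleftrightarrow> p \<noteq> [] \<and> distinct p \<and> successively (\<lambda>x y. (x, y) \<in> E) p \<and> hd p \<in> A \<and> last p = b"

lemma successively_stays:
  assumes "successively (\<lambda>x y. (x, y) \<in> E) p" "p \<noteq> []" "hd p \<in> U"
    and "\<And>x y. x \<in> U \<Longrightarrow> (x, y) \<in> E \<Longrightarrow> y \<in> set p \<Longrightarrow> y \<in> U"
  shows "set p \<subseteq> U"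
  using assms
proof (induction p)
  case (Cons x p)
  show ?case
  proof (cases p)
    case Nil
    then show ?thesis using Cons.prems(3) by simp
  next
    case (Cons y q)
    have "y \<in> U" using Cons Cons.prems(1,3) Cons.prems(4)[of x y] by simp
    moreover have "w \<in> U" if "v \<in> U" "(v, w) \<in> E" "w \<in> set p" for v w
      using Cons.prems(4)[OF that(1,2)] that(3) by simp
    ultimately have "set p \<subseteq> U" using Cons Cons.prems(1) by (intro Cons.IH) auto
    then show ?thesis using Cons.prems(3) by simp
  qed
qed simp

text \<open>Closure of \<open>U\<close> is demanded only on \<open>tl p\<close>, because the paths
  to which this is applied start on a separator and avoid it afterwards.\<close>

lemma successively_enters_stays:
  assumes "successively (\<lambda>x y. (x, y) \<in> E) p" "v \<in> set p" "v \<in> U"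
    and "\<And>x y. x \<in> U \<Longrightarrow> (x, y) \<in> E \<Longrightarrow> y \<in> set (tl p) \<Longrightarrow> y \<in> U"
  shows "last p \<in> U"
proof -
  obtain xs ys where p: "p = xs @ v # ys" using assms(2) by (meson split_list)
  have tl: "set ys \<subseteq> set (tl p)" using p by (cases xs) auto
  have "set (v # ys) \<subseteq> insert v U"
  proof (rule successively_stays[where E = E])
    show "successively (\<lambda>x y. (x, y) \<in> E) (v # ys)" using assms(1) p by (simp add: successively_append_iff)
    fix x y assume "x \<in> insert v U" "(x, y) \<in> E" "y \<in> set (v # ys)"
    then show "y \<in> insert v U" using assms(3) assms(4)[of x y] tl by auto
  qed auto
  moreover have "last p \<in> set (v # ys)" using p by (metis last_appendR last_in_set list.distinct(1))
  ultimately show ?thesis using assms(3) by blast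
qed

lemma path_between_mono:
  assumes "path_between E A b p" "E \<subseteq> E'"
  shows "path_between E' A b p"
  using assms successively_mono[of "\<lambda>x y. (x, y) \<in> E" p "\<lambda>x y. (x, y) \<in> E'"]
  unfolding path_between_def by blast

text \<open>
  Goering's induction on the arcs: if removing the arc $(x, y)$ creates a separator $C$ with fewer
  than $k$ vertices, then linkages from $A$ to $C \cup \{x\}$ and from $C \cup \{y\}$ to $B$ meet only
  in $C$ and are glued there and along $(x, y)$.
\<close>

theorem menger:
  assumes "finite E" "finite A" "finite B" "\<And>C. finite C \<Longrightarrow> separates E A B C \<Longrightarrow> k \<le> card C"
  shows "\<exists>K p. K \<subseteq> B \<and> card K = k \<and> (\<forall>b\<in>K. path_between E A b (p b)) \<and>
    (\<forall>b\<in>K. \<forall>b'\<in>K. b \<noteq> b' \<longrightarrow> set (p b) \<inter> set (p b') = {})"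
  using assms
proof (induction E arbitrary: A B rule: finite_induct)
  case empty
  \<comment> \<open>Without arcs the only paths are the single vertices of
    \<open>A \<inter> B\<close>.\<close>
  have "separates {} A B (A \<inter> B)" unfolding separates_def by (rule exI[of _ "A - B"]) auto
  then have "k \<le> card (A \<inter> B)" using empty by auto
  then obtain K where "K \<subseteq> A \<inter> B" "card K = k" by (meson obtain_subset_with_card_n)
  then show ?case
    by (intro exI[of _ K] exI[of _ "\<lambda>b. [b]"]) (auto simp: path_between_def)
next
  case (insert xy E)
  obtain x y where xy: "xy = (x, y)" by fastforce
  show ?case
  proof (cases "\<forall>C. finite C \<longrightarrow> separates E A B C \<longrightarrow> k \<le> card C")
    case True
    then obtain K p where Kp: "K \<subseteq> B" "card K = k" "\<forall>b\<in>K. path_between E A b (p b)"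
      "\<forall>b\<in>K. \<forall>b'\<in>K. b \<noteq> b' \<longrightarrow> set (p b) \<inter> set (p b') = {}"
      using insert.IH[OF insert.prems(1,2)] by blast
    have "\<forall>b\<in>K. path_between (insert xy E) A b (p b)"
      using Kp(3) path_between_mono[of E A _ _ "insert xy E"] by (simp add: subset_insertI)
    then show ?thesis using Kp by (intro exI[of _ K] exI[of _ p] conjI)
  next
    case False
    then obtain C where C: "finite C" "separates E A B C" "card C < k" by auto
    then obtain U where U: "A \<subseteq> U \<union> C" "U \<inter> C = {}" "U \<inter> B = {}" "E `` U \<subseteq> U \<union> C"
      unfolding separates_def by blast
    have nsep: "\<not> separates (insert xy E) A B C" using insert.prems(3)[OF C(1)] C(3) by auto
    \<comment> \<open>The side \<open>U\<close> is closed for \<open>E\<close> up to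
      \<open>C\<close> but cannot be so with the new arc, so this arc leaves \<open>U\<close> and
      misses \<open>C\<close>.\<close>
    have xU: "x \<in> U" and yU: "y \<notin> U \<union> C"
    proof -
      have "\<not> (x \<notin> U \<or> y \<in> U \<union> C)"
      proof
        assume "x \<notin> U \<or> y \<in> U \<union> C"
        then have "insert xy E `` U \<subseteq> U \<union> C" using U(4) xy by auto
        then show False using nsep U unfolding separates_def by blast
      qed
      then show "x \<in> U" "y \<notin> U \<union> C" by auto
    qed
    \<comment> \<open>A separator on the near side also separates \<open>A\<close> from
      \<open>B\<close> in the full digraph: take the intersection of the two sides. It does not
      contain \<open>x\<close>, so the new arc does not start there.\<close>
    have "k \<le> card C1" if c: "finite C1" "separates E A (insert x C) C1" for C1
    proof (rule insert.prems(3)[OF c(1)])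
      obtain U1 where U1: "A \<subseteq> U1 \<union> C1" "U1 \<inter> C1 = {}" "U1 \<inter> insert x C = {}" "E `` U1 \<subseteq> U1 \<union> C1"
        using c(2) unfolding separates_def by blast
      have "insert xy E `` (U1 \<inter> U) \<subseteq> E `` U1 \<inter> E `` U" using U1(3) xy by auto
      then have "insert xy E `` (U1 \<inter> U) \<subseteq> U1 \<inter> U \<union> C1" using U(4) U1(3,4) by blast
      moreover have "A \<subseteq> U1 \<inter> U \<union> C1" using U1(1,3) U(1) by blast
      moreover have "U1 \<inter> U \<inter> C1 = {}" "U1 \<inter> U \<inter> B = {}" using U1(2) U(3) by blast+
      ultimately show "separates (insert xy E) A B C1" unfolding separates_def by blast
    qed
    then obtain K1 p1 where K1: "K1 \<subseteq> insert x C" "card K1 = k"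
      and p1: "\<And>b. b \<in> K1 \<Longrightarrow> path_between E A b (p1 b)"
      and d1: "\<And>b b'. b \<in> K1 \<Longrightarrow> b' \<in> K1 \<Longrightarrow> b \<noteq> b' \<Longrightarrow> set (p1 b) \<inter> set (p1 b') = {}"
      using insert.IH[of A "insert x C"] insert.prems(1) C(1) by (metis finite_insert)
    \<comment> \<open>Dually, the union of the two sides works, since \<open>y\<close> lies in
      \<open>U2 \<union> C2\<close> and the new arc therefore stays inside.\<close>
    have "k \<le> card C2" if c: "finite C2" "separates E (insert y C) B C2" for C2
    proof (rule insert.prems(3)[OF c(1)])
      obtain U2 where U2: "insert y C \<subseteq> U2 \<union> C2" "U2 \<inter> B = {}" "E `` U2 \<subseteq> U2 \<union> C2"
        using c(2) unfolding separates_def by blast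
      let ?U = "(U \<union> U2) - C2"
      have "insert xy E `` ?U \<subseteq> insert y (E `` U \<union> E `` U2)" using xy by auto
      then have "insert xy E `` ?U \<subseteq> ?U \<union> C2" using U(4) U2(1,3) by blast
      moreover have "A \<subseteq> ?U \<union> C2" using U2(1) U(1) by blast
      moreover have "?U \<inter> C2 = {}" "?U \<inter> B = {}" using U2(2) U(3) by blast+
      ultimately show "separates (insert xy E) A B C2" unfolding separates_def by blast
    qed
    then obtain K2 p2 where K2: "K2 \<subseteq> B" "card K2 = k"
      and p2: "\<And>b. b \<in> K2 \<Longrightarrow> path_between E (insert y C) b (p2 b)"
      and d2: "\<And>b b'. b \<in> K2 \<Longrightarrow> b' \<in> K2 \<Longrightarrow> b \<noteq> b' \<Longrightarrow> set (p2 b) \<inter> set (p2 b') = {}"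
      using insert.IH[of "insert y C" B] insert.prems(2) C(1) by (metis finite_insert)
    \<comment> \<open>Since both linkages have \<open>k\<close> paths, the first ends in every
      vertex of \<open>insert x C\<close> and the second starts in every vertex of
      \<open>insert y C\<close>.\<close>
    have card_le: "card (insert v C) \<le> k" for v using C(3) card_insert_le_m1[of k C v] C(1) by (simp add: card_insert_if)
    have K1_eq: "K1 = insert x C"
      using K1 card_le[of x] C(1) by (intro card_subset_eq) (auto intro!: antisym card_mono)
    have hd2: "hd (p2 b) \<in> insert y C" "p2 b \<noteq> []" "hd (p2 b) \<in> set (p2 b)" if "b \<in> K2" for b
      using p2[OF that] unfolding path_between_def by auto
    have inj2: "inj_on (\<lambda>b. hd (p2 b)) K2"
      using d2 hd2(3) unfolding inj_on_def by (metis disjoint_iff)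
    have hd2_surj: "(\<lambda>b. hd (p2 b)) ` K2 = insert y C"
    proof (rule card_subset_eq)
      show "card ((\<lambda>b. hd (p2 b)) ` K2) = card (insert y C)"
        using card_image[OF inj2] K2(2) card_le[of y] card_mono[of "insert y C" "(\<lambda>b. hd (p2 b)) ` K2"] hd2(1) C(1)
        by fastforce
    qed (use C(1) hd2(1) in auto)
    \<comment> \<open>Every vertex of \<open>insert x C\<close> ends its own path, so disjointness
      forbids meeting this set earlier. The same reason gives \<open>start2\<close>.\<close>
    have end1: "v = s" if "s \<in> K1" "v \<in> set (p1 s)" "v \<in> insert x C" for s v
    proof (rule ccontr)
      assume "v \<noteq> s"
      moreover have "v \<in> set (p1 v)" using p1[of v] that(3) K1_eq unfolding path_between_def by (metis last_in_set)
      ultimately show False using d1[OF that(1), of v] that K1_eq by blast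
    qed
    have start2: "v = hd (p2 b)" if b: "b \<in> K2" "v \<in> set (p2 b)" "v \<in> insert y C" for b v
    proof -
      obtain b' where "b' \<in> K2" "v = hd (p2 b')" using hd2_surj b(3) by (metis (no_types, lifting) imageE)
      then show ?thesis using d2[OF b(1), of b'] b(2) hd2(3)[of b'] by blast
    qed
    have in1: "set (p1 s) \<subseteq> U \<union> {s}" if s: "s \<in> K1" for s
    proof -
      have s1: "successively (\<lambda>x y. (x, y) \<in> E) (p1 s)" "p1 s \<noteq> []" "distinct (p1 s)" "last (p1 s) = s" "hd (p1 s) \<in> A"
        using p1[OF s] unfolding path_between_def by auto
      then have p1s: "p1 s = butlast (p1 s) @ [s]" by (metis append_butlast_last_id)
      then have notC: "v \<notin> insert x C" if "v \<in> set (butlast (p1 s))" for v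
        using that end1[OF s, of v] s1(3) by (metis Un_iff disjoint_insert(1) distinct_append list.simps(15) set_append)
      have "set (butlast (p1 s)) \<subseteq> U"
      proof (cases "butlast (p1 s) = []")
        case False
        show ?thesis
        proof (rule successively_stays[where E = E])
          show "successively (\<lambda>x y. (x, y) \<in> E) (butlast (p1 s))"
            using s1(1) p1s by (metis successively_append_iff)
          have "hd (butlast (p1 s)) = hd (p1 s)" using False p1s by (metis hd_append2)
          then show "hd (butlast (p1 s)) \<in> U"
            using notC[OF hd_in_set[OF False]] s1(5) U(1) by auto
          show "w \<in> U" if "v \<in> U" "(v, w) \<in> E" "w \<in> set (butlast (p1 s))" for v w
            using that notC[of w] U(4) by blast
        qed (rule False)
      qed simp
      moreover have "set (p1 s) = set (butlast (p1 s)) \<union> {s}" by (subst p1s) simp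
      ultimately show ?thesis by auto
    qed
    have out2: "set (p2 b) \<inter> U = {}" if b: "b \<in> K2" for b
    proof (rule ccontr)
      assume "set (p2 b) \<inter> U \<noteq> {}"
      then obtain v where v: "v \<in> set (p2 b)" "v \<in> U" by blast
      have dist: "distinct (p2 b)" "successively (\<lambda>x y. (x, y) \<in> E) (p2 b)" "last (p2 b) = b"
        using p2[OF b] unfolding path_between_def by auto
      have "last (p2 b) \<in> U"
      proof (rule successively_enters_stays[OF dist(2) v])
        fix s t assume st: "s \<in> U" "(s, t) \<in> E" "t \<in> set (tl (p2 b))"
        then have "t \<in> U \<union> C" "t \<in> set (p2 b)" using U(4) hd2(2)[OF b] by (auto dest: list.set_sel(2))
        moreover have "t \<noteq> hd (p2 b)" using st(3) dist(1) hd2(2)[OF b] by (cases "p2 b") auto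
        ultimately show "t \<in> U" using start2[OF b] by blast
      qed
      then show False using dist(3) b K2(1) U(3) by auto
    qed
    have meet: "v = s \<and> v = hd (p2 b) \<and> v \<in> C" if "s \<in> K1" "b \<in> K2" "v \<in> set (p1 s)" "v \<in> set (p2 b)" for s b v
    proof -
      have "v = s" "v \<notin> U" using in1[OF that(1)] out2[OF that(2)] that(3,4) by auto
      then have "v \<in> C" using that(1) K1_eq xU by auto
      then show ?thesis using start2[OF that(2,4)] \<open>v = s\<close> by auto
    qed
    \<comment> \<open>Gluing goes along the arc \<open>(x, y)\<close> if the second path starts in
      \<open>y\<close>, and otherwise at the common vertex of \<open>C\<close>, whose second copy is
      dropped by \<open>tl\<close>.\<close>
    define q where "q b = (if hd (p2 b) = y then p1 x @ p2 b else p1 (hd (p2 b)) @ tl (p2 b))" for b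
    define src where "src b = (if hd (p2 b) = y then x else hd (p2 b))" for b
    have src: "src b \<in> K1" if "b \<in> K2" for b
      unfolding src_def K1_eq using hd2(1)[OF that] by auto
    have xC: "x \<notin> C" "x \<noteq> y" using xU yU U(2) by auto
    have src_inj: "src b \<noteq> src b'" if "b \<in> K2" "b' \<in> K2" "b \<noteq> b'" for b b'
      using inj2 that hd2(1)[OF that(1)] hd2(1)[OF that(2)] xC unfolding src_def inj_on_def by auto
    have setq: "set (q b) = set (p1 (src b)) \<union> set (p2 b)" if "b \<in> K2" for b
    proof (cases "hd (p2 b) = y")
      case False
      then have "hd (p2 b) \<in> K1" using hd2(1)[OF that] K1_eq by auto
      then have "hd (p2 b) \<in> set (p1 (hd (p2 b)))" using p1 unfolding path_between_def by (metis last_in_set)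
      then have "set (p2 b) \<union> set (p1 (hd (p2 b))) = set (tl (p2 b)) \<union> set (p1 (hd (p2 b)))"
        using hd2(2)[OF that] by (cases "p2 b") auto
      then show ?thesis using False unfolding q_def src_def by auto
    qed (auto simp: q_def src_def)
    have "path_between (insert xy E) A b (q b)" if b: "b \<in> K2" for b
    proof -
      let ?E = "insert xy E"
      have s1: "successively (\<lambda>x y. (x, y) \<in> ?E) (p1 (src b))" "p1 (src b) \<noteq> []" "distinct (p1 (src b))"
        "hd (p1 (src b)) \<in> A" "last (p1 (src b)) = src b"
        using path_between_mono[OF p1[OF src[OF b]], of ?E] unfolding path_between_def by auto
      have s2: "successively (\<lambda>x y. (x, y) \<in> ?E) (p2 b)" "p2 b \<noteq> []" "distinct (p2 b)" "last (p2 b) = b"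
        using path_between_mono[OF p2[OF b], of ?E] unfolding path_between_def by auto
      show ?thesis
      proof (cases "hd (p2 b) = y")
        case True
        have "set (p1 (src b)) \<inter> set (p2 b) = {}"
          using meet[OF src[OF b] b] True xC yU unfolding src_def by auto
        then show ?thesis using s1 s2 True xy unfolding path_between_def q_def src_def
          by (auto simp: successively_append_iff)
      next
        case False
        have "set (p1 (src b)) \<inter> set (p2 b) \<subseteq> {hd (p2 b)}"
          using meet[OF src[OF b] b] by auto
        then show ?thesis using s1 s2 False unfolding path_between_def q_def src_def
          by (cases "p2 b") (auto simp: successively_append_iff successively_Cons)
      qed
    qed
    moreover have "set (q b) \<inter> set (q b') = {}" if b: "b \<in> K2" "b' \<in> K2" "b \<noteq> b'" for b b'
    proof -
      have cross: "set (p1 (src b)) \<inter> set (p2 b') = {}" if b: "b \<in> K2" "b' \<in> K2" "b \<noteq> b'" for b b'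
      proof (rule ccontr)
        assume "set (p1 (src b)) \<inter> set (p2 b') \<noteq> {}"
        then obtain v where "v = src b" "v = hd (p2 b')" "v \<in> C" using meet[OF src[OF b(1)] b(2)] by blast
        then have "hd (p2 b) = hd (p2 b')" using xC(1) unfolding src_def by (auto split: if_splits)
        then show False using inj2 b unfolding inj_on_def by blast
      qed
      show ?thesis
        unfolding setq[OF b(1)] setq[OF b(2)]
        using cross[OF b] cross[OF b(2,1) b(3)[symmetric]] d1[OF src[OF b(1)] src[OF b(2)] src_inj[OF b]] d2[OF b]
        by (simp add: Int_Un_distrib Int_Un_distrib2 Int_commute)
    qed
    ultimately show ?thesis using K2 by (intro exI[of _ K2] exI[of _ q] conjI ballI impI)
  qed
qed

subsection \<open>Near cuts\<close>

text \<open>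
  The separator of a near cut $(A, B)$ is implicit: it is $V - A - B$.
\<close>

definition near_cut :: "'a set \<Rightarrow> ('a \<times> 'a) set \<Rightarrow> nat \<Rightarrow> 'a set \<Rightarrow> 'a set \<Rightarrow> bool" where
  "near_cut V E b A B \<longleftrightarrow> A \<subseteq> V \<and> B \<subseteq> V \<and> A \<inter> B = {} \<and> card (V - A - B) \<le> b \<and>
     (\<forall>x\<in>A. \<forall>y\<in>B. (x, y) \<notin> E)"

text \<open>A vertex that the separator cannot spare: it can be moved neither to \<open>A\<close>
  nor to \<open>B\<close> without creating an arc from \<open>A\<close> to \<open>B\<close>.\<close>

definition crosses :: "'a set \<Rightarrow> ('a \<times> 'a) set \<Rightarrow> 'a set \<Rightarrow> 'a set \<Rightarrow> 'a \<Rightarrow> bool" where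
  "crosses V E A B y \<longleftrightarrow> y \<in> V - A - B \<and> (\<exists>a\<in>A. (a, y) \<in> E) \<and> (\<exists>c\<in>B. (y, c) \<in> E)"

lemma near_cut_converse: "near_cut V (E\<inverse>) b B A \<longleftrightarrow> near_cut V E b A B"
proof -
  have "V - B - A = V - A - B" by auto
  then show ?thesis unfolding near_cut_def by auto
qed

text \<open>\<open>E\<close> is not confined to \<open>V\<close>, so that one arc set serves both
  the whole digraph and the digraph without the images of the sources.\<close>

locale semicomplete_arcs =
  fixes V :: "'a set" and E :: "('a \<times> 'a) set"
  assumes finV: "finite V"
    and total: "\<And>x y. x \<in> V \<Longrightarrow> y \<in> V \<Longrightarrow> x \<noteq> y \<Longrightarrow> (x, y) \<in> E \<or> (y, x) \<in> E"
begin

lemma converse: "semicomplete_arcs V (E\<inverse>)"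
  using finV total by unfold_locales auto

text \<open>For \<open>u \<in> A \<inter> B'\<close> and \<open>v \<in> A' \<inter> B\<close>, the
  first cut forbids the arc from \<open>u\<close> to \<open>v\<close> and the second the arc from
  \<open>v\<close> to \<open>u\<close>.\<close>

lemma near_cuts_nested:
  assumes "near_cut V E b A B" "near_cut V E b A' B'"
  shows "A \<inter> B' = {} \<or> A' \<inter> B = {}"
proof (rule ccontr)
  assume "\<not> ?thesis"
  then obtain u v where "u \<in> A \<inter> B'" "v \<in> A' \<inter> B" by blast
  moreover from this have "u \<noteq> v" "u \<in> V" "v \<in> V" using assms unfolding near_cut_def by auto
  ultimately show False using total[of u v] assms unfolding near_cut_def by blast
qed

text \<open>By nestedness either \<open>A - A'\<close> lies in the separator of the second cut, or
  \<open>A' - A\<close> lies in that of the first and the size comparison turns this into a bound on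
  \<open>A - A'\<close>.\<close>

lemma near_cut_diff:
  assumes "near_cut V E b A B" "near_cut V E b A' B'" "card A \<le> card A' + b"
  shows "card (A - A') \<le> 2 * b"
proof -
  have sub: "A \<subseteq> V" "A' \<subseteq> V" using assms(1,2) unfolding near_cut_def by auto
  then have fin: "finite A" "finite A'" using finV finite_subset by auto
  from near_cuts_nested[OF assms(1,2)] show ?thesis
  proof
    assume "A \<inter> B' = {}"
    then have "A - A' \<subseteq> V - A' - B'" using sub by auto
    then have "card (A - A') \<le> card (V - A' - B')" using finV by (intro card_mono) auto
    then show ?thesis using assms(2) unfolding near_cut_def by auto
  next
    assume "A' \<inter> B = {}"
    then have "A' - A \<subseteq> V - A - B" using sub by auto
    then have "card (A' - A) \<le> card (V - A - B)" using finV by (intro card_mono) auto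
    then have "card (A' - A) \<le> b" using assms(1) unfolding near_cut_def by auto
    moreover have "card A = card (A \<inter> A') + card (A - A')" using fin card_Int_Diff by blast
    moreover have "card A' = card (A' \<inter> A) + card (A' - A)" using fin card_Int_Diff by blast
    moreover have "A \<inter> A' = A' \<inter> A" by auto
    ultimately show ?thesis using assms(3) by simp
  qed
qed

text \<open>Each \<open>y\<close> gets a cut with an out-neighbour \<open>c y\<close> on its far
  side. If \<open>j \<in> A' i\<close> and \<open>c j\<close> avoids the separator of the cut of
  \<open>i\<close>, then \<open>c j \<in> A' i\<close>. If this held in both directions, neither arc
  between \<open>c i\<close> and \<open>c j\<close> could exist. So the failures form a relation
  that is total on \<open>Y\<close>, and its out-degrees are bounded.\<close>

lemma card_late_vertices:
  assumes "finite Y" "Y \<subseteq> A"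
    and late: "\<And>y. y \<in> Y \<Longrightarrow> \<exists>A' B'. near_cut V E b A' B' \<and> y \<in> V - A' - B' \<and> (\<exists>c\<in>B'. (y, c) \<in> E) \<and> card (A - A') \<le> d"
    and finA: "finite A"
  shows "card Y \<le> 2 * (d + b * d) + 1"
proof -
  have "\<exists>c A' B'. near_cut V E b A' B' \<and> y \<in> V - A' - B' \<and> c \<in> B' \<and> (y, c) \<in> E \<and> card (A - A') \<le> d" if "y \<in> Y" for y
    using late[OF that] by blast
  then obtain c A' B' where cut: "\<And>y. y \<in> Y \<Longrightarrow> near_cut V E b (A' y) (B' y)"
    and c: "\<And>y. y \<in> Y \<Longrightarrow> c y \<in> B' y" "\<And>y. y \<in> Y \<Longrightarrow> (y, c y) \<in> E"
    and d: "\<And>y. y \<in> Y \<Longrightarrow> card (A - A' y) \<le> d"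
    by metis
  define \<rho> where "\<rho> i j \<longleftrightarrow> j \<notin> A' i \<or> c j \<in> V - A' i - B' i" for i j
  have miss: "card {j \<in> Y. j \<notin> A' i} \<le> d" if "i \<in> Y" for i
  proof -
    have "card {j \<in> Y. j \<notin> A' i} \<le> card (A - A' i)" using assms(2) finA by (intro card_mono) auto
    then show ?thesis using d[OF that] by simp
  qed
  \<comment> \<open>If \<open>\<beta> = c i\<close>, then every \<open>j\<close> with
    \<open>c j = \<beta>\<close> sends an arc into \<open>B' i\<close>, so it is missing from
    \<open>A' i\<close>.\<close>
  have fib: "card {j \<in> Y. c j = \<beta>} \<le> d" for \<beta>
  proof (cases "\<exists>i\<in>Y. c i = \<beta>")
    case True
    then obtain i where i: "i \<in> Y" "c i = \<beta>" by auto
    have "{j \<in> Y. c j = \<beta>} \<subseteq> {j \<in> Y. j \<notin> A' i}"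
      using c cut[OF i(1)] i unfolding near_cut_def by force
    then have "card {j \<in> Y. c j = \<beta>} \<le> card {j \<in> Y. j \<notin> A' i}" using assms(1) by (intro card_mono) auto
    then show ?thesis using miss[OF i(1)] by simp
  next
    case False
    then have "{j \<in> Y. c j = \<beta>} = {}" by auto
    then show ?thesis by (metis card.empty le0)
  qed
  have "card {j \<in> Y. \<rho> i j} \<le> d + b * d" if i: "i \<in> Y" for i
  proof -
    let ?Q = "V - A' i - B' i"
    have "{j \<in> Y. \<rho> i j} \<subseteq> {j \<in> Y. j \<notin> A' i} \<union> (\<Union>\<beta>\<in>?Q. {j \<in> Y. c j = \<beta>})"
      unfolding \<rho>_def by auto
    then have "card {j \<in> Y. \<rho> i j} \<le> card ({j \<in> Y. j \<notin> A' i} \<union> (\<Union>\<beta>\<in>?Q. {j \<in> Y. c j = \<beta>}))"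
      using assms(1) finV by (intro card_mono) auto
    also have "\<dots> \<le> card {j \<in> Y. j \<notin> A' i} + card (\<Union>\<beta>\<in>?Q. {j \<in> Y. c j = \<beta>})" by (rule card_Un_le)
    also have "card (\<Union>\<beta>\<in>?Q. {j \<in> Y. c j = \<beta>}) \<le> (\<Sum>\<beta>\<in>?Q. card {j \<in> Y. c j = \<beta>})"
      using finV by (intro card_UN_le) auto
    also have "\<dots> \<le> card ?Q * d" using sum_bounded_above[of ?Q "\<lambda>\<beta>. card {j \<in> Y. c j = \<beta>}" d] fib by simp
    also have "\<dots> \<le> b * d" using cut[OF i] unfolding near_cut_def by simp
    finally show ?thesis using miss[OF i] by linarith
  qed
  moreover have "\<rho> i j \<or> \<rho> j i" if ij: "i \<in> Y" "j \<in> Y" "i \<noteq> j" for i j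
  proof (rule ccontr)
    assume "\<not> ?thesis"
    then have n: "j \<in> A' i" "c j \<notin> V - A' i - B' i" "i \<in> A' j" "c i \<notin> V - A' j - B' j" unfolding \<rho>_def by auto
    have cV: "c i \<in> V" "c j \<in> V" using c(1) cut ij unfolding near_cut_def by blast+
    have "c j \<notin> B' i" using n(1) c(2)[OF ij(2)] cut[OF ij(1)] unfolding near_cut_def by blast
    then have cj: "c j \<in> A' i" using n(2) cV by blast
    have "c i \<notin> B' j" using n(3) c(2)[OF ij(1)] cut[OF ij(2)] unfolding near_cut_def by blast
    then have ci: "c i \<in> A' j" using n(4) cV by blast
    have "c i \<noteq> c j" using cj c(1)[OF ij(1)] cut[OF ij(1)] unfolding near_cut_def by auto
    then show False using total[OF cV] cj ci c(1) cut ij unfolding near_cut_def by blast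
  qed
  ultimately show ?thesis using card_le_of_total_relation[OF assms(1), of \<rho> "d + b * d"] by blast
qed

text \<open>Take the cut with the smallest \<open>A\<close>. A crossing vertex in \<open>F\<close>
  lies in its separator or in \<open>A\<close>. In the second case it is late: by minimality
  \<open>A\<close> is contained in the first side of the cut that it crosses up to
  \<open>2 * b\<close> vertices.\<close>

lemma card_crossing_vertices:
  assumes cuts: "\<And>A B. (A, B) \<in> \<C> \<Longrightarrow> near_cut V E b A B"
    and F: "finite F" "\<And>A B. (A, B) \<in> \<C> \<Longrightarrow> F \<inter> B = {}"
  shows "card {y \<in> F. \<exists>(A, B)\<in>\<C>. crosses V E A B y} \<le> b + (2 * (2 * b + b * (2 * b)) + 1)"
proof (cases "\<C> = {}")
  case False
  then obtain A B where AB: "(A, B) \<in> \<C>" and min: "\<And>A' B'. (A', B') \<in> \<C> \<Longrightarrow> card A \<le> card A'"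
    using ex_has_least_nat[of "\<lambda>c. c \<in> \<C>" _ "\<lambda>c. card (fst c)"] by (metis all_not_in_conv fst_conv surj_pair)
  let ?Y = "{y \<in> F. \<exists>(A, B)\<in>\<C>. crosses V E A B y}"
  have nc: "near_cut V E b A B" using cuts[OF AB] .
  have finA: "finite A" using nc finV finite_subset unfolding near_cut_def by metis
  have YV: "?Y \<subseteq> V" unfolding crosses_def by auto
  have "card (?Y \<inter> A) \<le> 2 * (2 * b + b * (2 * b)) + 1"
  proof (rule card_late_vertices[of _ A])
    fix y assume "y \<in> ?Y \<inter> A"
    then obtain A' B' where c': "(A', B') \<in> \<C>" "crosses V E A' B' y" by auto
    have "card (A - A') \<le> 2 * b" using near_cut_diff[OF nc cuts[OF c'(1)]] min[OF c'(1)] by simp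
    then show "\<exists>A' B'. near_cut V E b A' B' \<and> y \<in> V - A' - B' \<and> (\<exists>c\<in>B'. (y, c) \<in> E) \<and> card (A - A') \<le> 2 * b"
      using c' cuts unfolding crosses_def by blast
  qed (use F finA in auto)
  moreover have "card (V - A - B) \<le> b" using nc unfolding near_cut_def by auto
  moreover have "?Y \<subseteq> (V - A - B) \<union> (?Y \<inter> A)" using YV F(2)[OF AB] by blast
  then have "card ?Y \<le> card ((V - A - B) \<union> (?Y \<inter> A))" using finV finA by (intro card_mono) auto
  ultimately show ?thesis using card_Un_le[of "V - A - B" "?Y \<inter> A"] by linarith
qed simp

text \<open>
  As for interval graphs: a vertex whose last crossed cut comes earliest has few conflicts, since a
  vertex in conflict with it either lies in the separator of that cut or crosses a cut on the far
  side of it.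
\<close>

lemma conflict_degenerate:
  assumes cuts: "\<And>A B. (A, B) \<in> \<C> \<Longrightarrow> near_cut V E b A B"
    and U: "finite U" "U \<noteq> {}"
  shows "\<exists>v\<in>U. card {w \<in> U. w = v \<or> (\<exists>(A, B)\<in>\<C>. crosses V E A B v \<and> crosses V E A B w)}
    \<le> b + 2 * (2 * (2 * b + b * (2 * b)) + 1)"
proof (cases "\<exists>v\<in>U. \<forall>(A, B)\<in>\<C>. \<not> crosses V E A B v")
  case True
  then obtain v where v: "v \<in> U" "\<forall>(A, B)\<in>\<C>. \<not> crosses V E A B v" by blast
  then have "{w \<in> U. w = v \<or> (\<exists>(A, B)\<in>\<C>. crosses V E A B v \<and> crosses V E A B w)} = {v}" by auto
  then show ?thesis using v(1) by (intro bexI[of _ v]) auto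
next
  case False
  define hi where "hi v = Max {card A | A B. (A, B) \<in> \<C> \<and> crosses V E A B v}" for v
  have fin: "finite {card A | A B. (A, B) \<in> \<C> \<and> crosses V E A B v}" for v
  proof (rule finite_subset)
    show "{card A | A B. (A, B) \<in> \<C> \<and> crosses V E A B v} \<subseteq> {..card V}"
    proof
      fix k assume "k \<in> {card A | A B. (A, B) \<in> \<C> \<and> crosses V E A B v}"
      then obtain A B where "(A, B) \<in> \<C>" "k = card A" by blast
      then show "k \<in> {..card V}" using cuts[of A B] card_mono[OF finV, of A] unfolding near_cut_def by simp
    qed
  qed simp
  have hi_ge: "card A \<le> hi v" if "(A, B) \<in> \<C>" "crosses V E A B v" for v A B
    unfolding hi_def using fin that by (intro Max_ge) blast+
  have hi_ex: "\<exists>A B. (A, B) \<in> \<C> \<and> crosses V E A B v \<and> card A = hi v" if "v \<in> U" for v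
  proof -
    have "{card A | A B. (A, B) \<in> \<C> \<and> crosses V E A B v} \<noteq> {}" using False that by blast
    from Max_in[OF fin this] have "hi v \<in> {card A | A B. (A, B) \<in> \<C> \<and> crosses V E A B v}"
      unfolding hi_def .
    then show ?thesis by fastforce
  qed
  obtain v where v: "v \<in> U" "\<And>w. w \<in> U \<Longrightarrow> hi v \<le> hi w"
    using ex_has_least_nat[of "\<lambda>v. v \<in> U" _ hi] U(2) by (metis all_not_in_conv)
  obtain A B where AB: "(A, B) \<in> \<C>" "crosses V E A B v" "card A = hi v" using hi_ex[OF v(1)] by blast
  have nc: "near_cut V E b A B" using cuts[OF AB(1)] .
  have fins: "finite A" "finite B" using nc finV finite_subset unfolding near_cut_def by metis+
  let ?N = "{w \<in> U. w = v \<or> (\<exists>(A, B)\<in>\<C>. crosses V E A B v \<and> crosses V E A B w)}"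
  have NV: "?N \<subseteq> V" using AB(2) unfolding crosses_def by auto
  have part: "card V = card A + card B + card (V - A - B)" if "near_cut V E b A B" for A B
  proof -
    have "finite A" "finite B" "A \<subseteq> V" "B \<subseteq> V" "A \<inter> B = {}"
      using that finV finite_subset unfolding near_cut_def by metis+
    moreover have "V - A - B = V - (A \<union> B)" by auto
    moreover have "card (A \<union> B) \<le> card V" using calculation finV by (intro card_mono) auto
    ultimately show ?thesis by (simp add: card_Diff_subset card_Un_disjoint)
  qed
  have "card (?N \<inter> A) \<le> 2 * (2 * b + b * (2 * b)) + 1"
  proof (rule card_late_vertices[of _ A])
    fix w assume w: "w \<in> ?N \<inter> A"
    obtain A' B' where c': "(A', B') \<in> \<C>" "crosses V E A' B' w" "card A' = hi w"
      using hi_ex[of w] w by blast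
    \<comment> \<open>On this side the last cut crossed by \<open>w\<close> itself is used, which by
      the choice of \<open>v\<close> is not earlier than that of \<open>v\<close>.\<close>
    have "card A \<le> card A'" using c'(3) AB(3) v(2)[of w] w by simp
    then have "card (A - A') \<le> 2 * b" using near_cut_diff[OF nc cuts[OF c'(1)]] by simp
    then show "\<exists>A' B'. near_cut V E b A' B' \<and> w \<in> V - A' - B' \<and> (\<exists>c\<in>B'. (w, c) \<in> E) \<and> card (A - A') \<le> 2 * b"
      using c' cuts unfolding crosses_def by blast
  qed (use U fins in auto)
  moreover have "card (?N \<inter> B) \<le> 2 * (2 * b + b * (2 * b)) + 1"
  proof (rule semicomplete_arcs.card_late_vertices[OF converse, of _ B])
    fix w assume w: "w \<in> ?N \<inter> B"
    then have "w \<noteq> v" using AB(2) unfolding crosses_def by auto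
    then obtain A' B' where c': "(A', B') \<in> \<C>" "crosses V E A' B' v" "crosses V E A' B' w"
      using w by blast
    have nc': "near_cut V E b A' B'" using cuts[OF c'(1)] .
    \<comment> \<open>On the far side the common cut is used, with all arcs reversed. The sizes of
      the second sides can be compared only up to the size of a separator; this is the slack
      \<open>b\<close> allowed in \<open>near_cut_diff\<close>.\<close>
    have "card A' \<le> card A" using hi_ge[OF c'(1,2)] AB(3) by simp
    moreover have "card (V - A' - B') \<le> b" using nc' unfolding near_cut_def by auto
    ultimately have "card B \<le> card B' + b" using part[OF nc] part[OF nc'] by linarith
    then have "card (B - B') \<le> 2 * b"
      using semicomplete_arcs.near_cut_diff[OF converse, of b B A B' A'] nc nc' by (simp add: near_cut_converse)
    then show "\<exists>A' B'. near_cut V (E\<inverse>) b A' B' \<and> w \<in> V - A' - B' \<and> (\<exists>c\<in>B'. (w, c) \<in> E\<inverse>) \<and> card (B - A') \<le> 2 * b"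
      using c' nc' unfolding crosses_def by (intro exI[of _ B'] exI[of _ A']) (auto simp: near_cut_converse)
  qed (use U fins in auto)
  moreover have "card (V - A - B) \<le> b" using nc unfolding near_cut_def by auto
  moreover have "?N \<subseteq> (V - A - B) \<union> ((?N \<inter> A) \<union> (?N \<inter> B))" using NV by blast
  then have "card ?N \<le> card ((V - A - B) \<union> ((?N \<inter> A) \<union> (?N \<inter> B)))" using finV fins by (intro card_mono) auto
  then have "card ?N \<le> card (V - A - B) + (card (?N \<inter> A) + card (?N \<inter> B))"
    using card_Un_le[of "V - A - B" "(?N \<inter> A) \<union> (?N \<inter> B)"] card_Un_le[of "?N \<inter> A" "?N \<inter> B"] by linarith
  ultimately have "card ?N \<le> b + ((2 * (2 * b + b * (2 * b)) + 1) + (2 * (2 * b + b * (2 * b)) + 1))"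
    by (meson add_mono order_trans)
  then show ?thesis using v(1) by (intro bexI[of _ v]) simp_all
qed

end

subsection \<open>Hubs and routes\<close>

text \<open>If the first vertex \<open>y\<close> inside \<open>F\<close> is in \<open>F2\<close> and
  all of \<open>M y \<inter> F\<close> lies in \<open>F2 \<union> Z\<close>, then \<open>F2\<close>
  has almost \<open>t\<close> elements. Some \<open>v \<in> F2\<close> has at most half of
  \<open>F2\<close> in \<open>M v\<close>, so \<open>M v \<inter> F\<close> has at most
  \<open>card F - card F2 / 2\<close> elements. That is well below \<open>t\<close>, although almost
  all of \<open>M v\<close> must lie in \<open>F\<close>.\<close>

lemma escape:
  fixes E :: "('a \<times> 'a) set" and M :: "'a \<Rightarrow> 'a set"
  assumes fin: "finite F" "finite Z" "\<And>v. finite (E `` {v})"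
    and ME: "\<And>v. v \<in> F \<Longrightarrow> M v \<subseteq> E `` {v}"
    and asym: "\<And>v w. v \<in> F \<Longrightarrow> w \<in> F \<Longrightarrow> w \<in> M v \<Longrightarrow> v \<notin> M w"
    and Mdeg: "\<And>v. v \<in> F \<Longrightarrow> t \<le> card (M v)"
    and deg: "\<And>v. v \<in> insert s F \<Longrightarrow> d \<le> card (E `` {v})"
    and F: "9 * card F \<le> 10 * t"
    and d: "8 * (K + card Z) \<le> d" "0 < K"
  shows "\<exists>ys. length ys \<le> 2 \<and> set ys \<subseteq> F - Z \<and> distinct ys \<and>
    successively (\<lambda>x y. (x, y) \<in> E) (s # ys) \<and> K \<le> card (E `` {last (s # ys)} - F - Z)"
proof -
  define F2 where "F2 = {v \<in> F - Z. card (E `` {v} - F - Z) < K}"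
  have split_card: "card W \<le> card (W \<inter> F) + card (E `` {v} - F - Z) + card Z" if "W \<subseteq> E `` {v}" for v W
  proof -
    have "W \<subseteq> (W \<inter> F) \<union> (E `` {v} - F - Z) \<union> Z" using that by auto
    then have "card W \<le> card ((W \<inter> F) \<union> (E `` {v} - F - Z) \<union> Z)" using fin by (intro card_mono) auto
    then show ?thesis
      using card_Un_le[of "(W \<inter> F) \<union> (E `` {v} - F - Z)" Z] card_Un_le[of "W \<inter> F" "E `` {v} - F - Z"] by linarith
  qed
  show ?thesis
  proof (cases "K \<le> card (E `` {s} - F - Z)")
    case True
    then show ?thesis by (intro exI[of _ "[]"]) auto
  next
    case False
    have "\<not> E `` {s} \<inter> F \<subseteq> Z"
    proof
      assume "E `` {s} \<inter> F \<subseteq> Z"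
      then have "card (E `` {s} \<inter> F) \<le> card Z" using fin(2) by (rule card_mono[rotated])
      then show False using split_card[of "E `` {s}" s] False deg[of s] d by auto
    qed
    then obtain y where y: "(s, y) \<in> E" "y \<in> F - Z" by blast
    show ?thesis
    proof (cases "y \<in> F2")
      case False
      then have "K \<le> card (E `` {y} - F - Z)" using y unfolding F2_def by auto
      then show ?thesis using y by (intro exI[of _ "[y]"]) auto
    next
      case True
      have F2: "v \<in> F" "t < card (M v \<inter> F) + K + card Z" "d < card F + K + card Z" if "v \<in> F2" for v
      proof -
        show v: "v \<in> F" using that unfolding F2_def by auto
        have small: "card (E `` {v} - F - Z) < K" using that unfolding F2_def by auto
        then show "t < card (M v \<inter> F) + K + card Z" using split_card[OF ME[OF v]] Mdeg[OF v] by linarith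
        have "card (E `` {v} \<inter> F) \<le> card F" using fin by (intro card_mono) auto
        then show "d < card F + K + card Z" using small split_card[of "E `` {v}" v] deg[of v] v by auto
      qed
      have "\<not> M y \<inter> F \<subseteq> F2 \<union> Z"
      proof
        assume "M y \<inter> F \<subseteq> F2 \<union> Z"
        moreover have finF2: "finite F2" "F2 \<subseteq> F" using fin unfolding F2_def by auto
        ultimately have "card (M y \<inter> F) \<le> card (F2 \<union> Z)" using fin by (intro card_mono) auto
        then have y1: "card (M y \<inter> F) \<le> card F2 + card Z" using card_Un_le[of F2 Z] by linarith
        obtain v where v: "v \<in> F2" "2 * card (M v \<inter> F2) \<le> card F2"
          using asymmetric_small_degree[of F2 M] finF2 True asym by blast
        have "M v \<inter> F \<subseteq> (M v \<inter> F2) \<union> (F - F2)" by auto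
        then have "card (M v \<inter> F) \<le> card ((M v \<inter> F2) \<union> (F - F2))" using fin finF2 by (intro card_mono) auto
        also have "\<dots> \<le> card (M v \<inter> F2) + card (F - F2)" by (rule card_Un_le)
        also have "card (F - F2) = card F - card F2" using finF2 by (simp add: card_Diff_subset)
        finally have "card (M v \<inter> F) + card F2 \<le> card (M v \<inter> F2) + card F"
          using card_mono[OF fin(1) finF2(2)] by linarith
        then have "card F2 + 2 * t < 2 * card F + 2 * K + 2 * card Z" using v(2) F2(2)[OF v(1)] by linarith
        moreover have "t < card F2 + K + 2 * card Z" using F2(2)[OF True] y1 by linarith
        ultimately have "3 * t < 2 * card F + 3 * K + 4 * card Z" by linarith
        \<comment> \<open>The ratio 10/9 leaves \<open>7 * t / 9\<close> on the left. On the other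
          hand the out-degree of \<open>y\<close> makes \<open>F\<close>, and with it
          \<open>t\<close>, larger than a multiple of \<open>K + card Z\<close> that contradicts
          this.\<close>
        then have "7 * t < 27 * K + 36 * card Z" using F by linarith
        moreover have "7 * K + 7 * card Z < card F" using F2(3)[OF True] d(1) by simp
        ultimately show False using F by linarith
      qed
      then obtain y' where y': "y' \<in> M y" "y' \<in> F - Z" "y' \<notin> F2" by blast
      then have "K \<le> card (E `` {y'} - F - Z)" unfolding F2_def by auto
      moreover have "y' \<noteq> y" "(y, y') \<in> E" using y' True ME y by blast+
      ultimately show ?thesis using y y' by (intro exI[of _ "[y, y']"]) auto
    qed
  qed
qed

lemma ex_smallest_subset:
  fixes \<mu> :: "'a \<Rightarrow> nat"
  assumes "finite S" "n \<le> card S"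
  shows "\<exists>X t. X \<subseteq> S \<and> card X = n \<and> (\<forall>x\<in>X. \<mu> x \<le> t) \<and> (\<forall>v\<in>S - X. t \<le> \<mu> v)"
  using assms(2)
proof (induction n)
  case 0
  show ?case by (intro exI[of _ "{}"] exI[of _ 0]) auto
next
  case (Suc n)
  then obtain X t where X: "X \<subseteq> S" "card X = n" "\<forall>x\<in>X. \<mu> x \<le> t" "\<forall>v\<in>S - X. t \<le> \<mu> v" by auto
  have "S - X \<noteq> {}" using Suc.prems X(1,2) assms(1) by (metis Diff_eq_empty_iff Suc_n_not_le_n subset_antisym)
  then obtain x where x: "x \<in> S - X" "\<And>v. v \<in> S - X \<Longrightarrow> \<mu> x \<le> \<mu> v"
    using ex_has_least_nat[of "\<lambda>v. v \<in> S - X" _ \<mu>] by (metis all_not_in_conv)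
  have "card (insert x X) = Suc n" using X(1,2) x(1) assms(1) finite_subset[of X S] by auto
  moreover have "\<forall>u\<in>insert x X. \<mu> u \<le> \<mu> x" using X(3,4) x(1) by (metis insert_iff le_trans order_refl)
  ultimately show ?case using X(1) x by (intro exI[of _ "insert x X"] exI[of _ "\<mu> x"]) auto
qed

text \<open>A path stops at an in-neighbour of its target, so that several disjoint paths can share
  one target.\<close>

definition linkage ::
  "('a \<times> 'a) set \<Rightarrow> 'a set \<Rightarrow> 'a set \<Rightarrow> 'i set \<Rightarrow> ('i \<Rightarrow> 'a) \<Rightarrow> ('i \<Rightarrow> 'a list) \<Rightarrow> bool" where
  "linkage E U X I tgt P \<longleftrightarrow>
     (\<forall>e\<in>I. P e \<noteq> [] \<and> distinct (P e) \<and> set (P e) \<subseteq> U \<and> successively (\<lambda>x y. (x, y) \<in> E) (P e) \<and>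
        hd (P e) \<in> X \<and> (last (P e), tgt e) \<in> E) \<and>
     (\<forall>e\<in>I. \<forall>e'\<in>I. e \<noteq> e' \<longrightarrow> set (P e) \<inter> set (P e') = {})"

text \<open>\<open>J (u, v)\<close> lists only the interior of a route, so routes with a common hub
  are still disjoint lists.\<close>

definition hub_routes :: "('a \<times> 'a) set \<Rightarrow> 'a set \<Rightarrow> 'a set \<Rightarrow> ('a \<times> 'a \<Rightarrow> 'a list) \<Rightarrow> bool" where
  "hub_routes E X W J \<longleftrightarrow>
     (\<forall>u\<in>X. \<forall>v\<in>X. u \<noteq> v \<longrightarrow> J (u, v) \<noteq> [] \<and> length (J (u, v)) \<le> 3 \<and> distinct (J (u, v)) \<and>
        set (J (u, v)) \<subseteq> W \<and> successively (\<lambda>x y. (x, y) \<in> E) (u # J (u, v) @ [v])) \<and>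
     (\<forall>u\<in>X. \<forall>v\<in>X. \<forall>u'\<in>X. \<forall>v'\<in>X. u \<noteq> v \<longrightarrow> u' \<noteq> v' \<longrightarrow> (u, v) \<noteq> (u', v') \<longrightarrow>
        set (J (u, v)) \<inter> set (J (u', v')) = {})"

text \<open>
  Arcs of routes are cheap and all others cost more than a whole route, so a cheapest linkage that
  touches a route out of an unused hub could be rerouted through that hub.
\<close>

fun cost :: "('a \<times> 'a) set \<Rightarrow> 'a list \<Rightarrow> nat" where
  "cost W (x # y # p) = (if (x, y) \<in> W then 1 else 10) + cost W (y # p)"
| "cost W p = 0"

lemma cost_split: "cost W (xs @ c # ys) = cost W (xs @ [c]) + cost W (c # ys)"
proof (induction xs)
  case (Cons x xs)
  then show ?case by (cases xs) auto
qed simp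

lemma cost_cheap: "successively (\<lambda>x y. (x, y) \<in> W) p \<Longrightarrow> cost W p \<le> length p"
  by (induction W p rule: cost.induct) auto

lemma cost_last: "xs \<noteq> [] \<Longrightarrow> cost W (xs @ [c]) \<ge> (if (last xs, c) \<in> W then 1 else 10)"
proof (induction xs)
  case (Cons x xs)
  then show ?case by (cases xs) auto
qed simp

text \<open>The exchange behind the minimality argument: the start of one path is replaced and the
  part from \<open>c\<close> on is kept, together with its end. With \<open>as = []\<close> a path
  is shortened to begin at a hub on it.\<close>

lemma linkage_update:
  assumes P: "linkage E U X I tgt P" and e: "e \<in> I"
    and p: "P e = xs @ c # ys"
    and as: "distinct as" "set as \<subseteq> U" "successively (\<lambda>x y. (x, y) \<in> E) (as @ [c])" "hd (as @ [c]) \<in> X"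
    and free: "set as \<inter> (\<Union>e\<in>I. set (P e)) = {}"
  shows "linkage E U X I tgt (P(e := as @ c # ys))"
proof -
  have Pe: "distinct (P e)" "set (P e) \<subseteq> U" "successively (\<lambda>x y. (x, y) \<in> E) (P e)" "(last (P e), tgt e) \<in> E"
    using P e unfolding linkage_def by auto
  have sub: "set (c # ys) \<subseteq> set (P e)" using p by auto
  have "successively (\<lambda>x y. (x, y) \<in> E) (c # ys)" using Pe(3) p by (simp add: successively_append_iff)
  then have "successively (\<lambda>x y. (x, y) \<in> E) (as @ c # ys)" using as(3) by (auto simp: successively_append_iff)
  moreover have "set as \<inter> set (c # ys) = {}" using free sub e by blast
  then have "distinct (as @ c # ys)" using Pe(1) p as(1) by auto
  moreover have "set (as @ c # ys) \<subseteq> U" using as(2) sub Pe(2) by auto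
  moreover have "hd (as @ c # ys) \<in> X" using as(4) by (cases as) auto
  moreover have "last (as @ c # ys) = last (P e)" using p by simp
  moreover have "set (as @ c # ys) \<inter> set (P e') = {}" if "e' \<in> I" "e' \<noteq> e" for e'
  proof -
    have "set (P e) \<inter> set (P e') = {}" using P e that unfolding linkage_def by blast
    moreover have "set as \<inter> set (P e') = {}" using free that by blast
    ultimately show ?thesis using sub by auto
  qed
  ultimately show ?thesis using P Pe(4) unfolding linkage_def
    by (auto simp: Int_commute)
qed

theorem linkage_avoiding_routes:
  assumes ex: "linkage E U X I tgt P0" and I: "finite I"
    and XU: "X \<subseteq> U" and W: "W \<subseteq> U - X" and J: "hub_routes E X W J"
  shows "\<exists>P. linkage E U X I tgt P \<and> (\<forall>e\<in>I. set (P e) \<inter> X = {hd (P e)}) \<and>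
     (\<forall>u\<in>X - (\<lambda>e. hd (P e)) ` I. \<forall>v\<in>X. u \<noteq> v \<longrightarrow> set (J (u, v)) \<inter> (\<Union>e\<in>I. set (P e)) = {})"
proof -
  \<comment> \<open>The cheap arcs are those of the routes except the last ones into a hub. Since
    routes are disjoint, at most one cheap arc enters any vertex.\<close>
  define WA where "WA = {(a, c). \<exists>u\<in>X. \<exists>v\<in>X. u \<noteq> v \<and> (\<exists>i. i < length (J (u, v)) \<and>
    a = (u # J (u, v)) ! i \<and> c = J (u, v) ! i)}"
  define tot where "tot P = (\<Sum>e\<in>I. cost WA (P e))" for P
  obtain P where P: "linkage E U X I tgt P" and min: "\<And>P'. linkage E U X I tgt P' \<Longrightarrow> tot P \<le> tot P'"
    using ex_has_least_nat[of "linkage E U X I tgt" P0 tot] ex by auto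
  have no_better: False if e: "e \<in> I" and p: "P e = xs @ c # ys"
    and as: "distinct as" "set as \<subseteq> U" "successively (\<lambda>x y. (x, y) \<in> E) (as @ [c])" "hd (as @ [c]) \<in> X"
    and free: "set as \<inter> (\<Union>e\<in>I. set (P e)) = {}"
    and less: "cost WA (as @ [c]) < cost WA (xs @ [c])" for e xs c ys as
  proof -
    have "cost WA (as @ c # ys) < cost WA (P e)" 
      using less cost_split[of WA as c ys] cost_split[of WA xs c ys] unfolding p by linarith
    then have "tot (P(e := as @ c # ys)) < tot P"
      unfolding tot_def using I e by (intro sum_strict_mono_ex1) auto
    then show False using min[OF linkage_update[OF P e p as free]] by simp
  qed
  have Pe: "P e \<noteq> []" "hd (P e) \<in> X" if "e \<in> I" for e using P that unfolding linkage_def by auto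
  have only_hd: "set (P e) \<inter> X = {hd (P e)}" if e: "e \<in> I" for e
  proof (rule ccontr)
    assume "\<not> ?thesis"
    then obtain c where c: "c \<in> set (P e)" "c \<in> X" "c \<noteq> hd (P e)" using Pe[OF e] by auto
    then obtain xs ys where p: "P e = xs @ c # ys" by (meson split_list)
    then have "xs \<noteq> []" using c(3) by auto
    then have "0 < cost WA (xs @ [c])" using cost_last[of xs c WA] by (auto split: if_splits)
    then show False using no_better[OF e p, of "[]"] c(2) by auto
  qed
  have "set (J (u, v)) \<inter> (\<Union>e\<in>I. set (P e)) = {}"
    if u: "u \<in> X - (\<lambda>e. hd (P e)) ` I" and v: "v \<in> X" "u \<noteq> v" for u v
  proof (rule ccontr)
    let ?A = "\<Union>e\<in>I. set (P e)"
    assume "set (J (u, v)) \<inter> ?A \<noteq> {}"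
    \<comment> \<open>Taking the first vertex \<open>c\<close> of the route on the linkage leaves
      the stretch from \<open>u\<close> to \<open>c\<close> free for rerouting.\<close>
    then have "\<exists>x\<in>set (J (u, v)). x \<in> ?A" by blast
    then obtain as c bs where Juv: "J (u, v) = as @ c # bs" and cA: "c \<in> ?A" and as: "\<forall>x\<in>set as. x \<notin> ?A"
      using split_list_first_prop[of "J (u, v)" "\<lambda>x. x \<in> ?A"] by blast
    obtain e where e: "e \<in> I" "c \<in> set (P e)" using cA by blast
    then obtain xs ys where p: "P e = xs @ c # ys" by (meson split_list)
    have uX: "u \<in> X" using u by auto
    have Jp: "length (J (u, v)) \<le> 3" "distinct (J (u, v))" "set (J (u, v)) \<subseteq> W"
      "successively (\<lambda>x y. (x, y) \<in> E) (u # J (u, v) @ [v])"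
      using J uX v unfolding hub_routes_def by auto
    have "c \<notin> X" using Jp(3) W Juv by auto
    then have xs: "xs \<noteq> []" using Pe(2)[OF e(1)] p by auto
    have unused: "u \<notin> ?A" using only_hd u by blast
    \<comment> \<open>The only cheap arc into \<open>c\<close> comes from its predecessor on the
      route, which is \<open>u\<close> or in \<open>as\<close>, and no linkage path contains that
      vertex.\<close>
    have "(last xs, c) \<notin> WA"
    proof
      assume "(last xs, c) \<in> WA"
      then obtain u' v' i where w: "u' \<in> X" "v' \<in> X" "u' \<noteq> v'" "i < length (J (u', v'))"
        "last xs = (u' # J (u', v')) ! i" "c = J (u', v') ! i" unfolding WA_def by blast
      have "c \<in> set (J (u', v'))" "c \<in> set (J (u, v))" using w Juv by auto
      then have "(u', v') = (u, v)" using J w(1-3) uX v unfolding hub_routes_def by blast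
      then have eq: "u' = u" "v' = v" by auto
      have "J (u, v) ! i = J (u, v) ! length as" using w(6) eq Juv by (simp add: nth_append)
      moreover have "length as < length (J (u, v))" "i < length (J (u, v))" using Juv w(4) eq by simp_all
      ultimately have "i = length as" using nth_eq_iff_index_eq[OF Jp(2)] by blast
      then have "last xs = (u # as @ c # bs) ! length as" using w(5) eq Juv by simp
      also have "\<dots> = (u # as) ! length as" by (simp add: nth_append nth_Cons')
      finally have "last xs \<in> set (u # as)" by (metis length_Cons lessI nth_mem)
      moreover have "last xs \<in> ?A" using xs p e(1) by (metis UN_I Un_iff last_in_set set_append)
      ultimately show False using as unused by auto
    qed
    then have ten: "10 \<le> cost WA (xs @ [c])" using cost_last[OF xs, of c WA] by simp
    have "successively (\<lambda>x y. (x, y) \<in> WA) (u # as @ [c])"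
    proof -
      have "successively (\<lambda>x y. (x, y) \<in> WA) (u # J (u, v))"
        unfolding successively_conv_nth WA_def using uX v by auto
      then have "successively (\<lambda>x y. (x, y) \<in> WA) ((u # as @ [c]) @ bs)" using Juv by simp
      then show ?thesis unfolding successively_append_iff[of _ "u # as @ [c]" bs] by blast
    qed
    then have "cost WA ((u # as) @ [c]) \<le> length (u # as @ [c])" using cost_cheap by fastforce
    also have "\<dots> < 10" using Jp(1) Juv by simp
    finally have less: "cost WA ((u # as) @ [c]) < cost WA (xs @ [c])" using ten by simp
    show False
    proof (rule no_better[OF e(1) p _ _ _ _ _ less])
      show "distinct (u # as)" "set (u # as) \<subseteq> U" using Jp(2,3) Juv W uX XU by auto
      show "successively (\<lambda>x y. (x, y) \<in> E) ((u # as) @ [c])"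
        using Jp(4) Juv successively_append_iff[of _ "u # as @ [c]" "bs @ [v]"] by simp
      show "hd ((u # as) @ [c]) \<in> X" using uX by simp
      show "set (u # as) \<inter> ?A = {}" using as unused by auto
    qed
  qed
  then show ?thesis using P only_hd by blast
qed

text \<open>The lists are chosen one after another; \<open>Z\<close> holds the entries of those
  already chosen.\<close>

lemma greedy_disjoint_lists:
  assumes "finite I"
    and step: "\<And>i Z. i \<in> I \<Longrightarrow> finite Z \<Longrightarrow> card Z \<le> k * card I \<Longrightarrow>
      \<exists>l. Q i l \<and> length l \<le> k \<and> set l \<inter> Z = {}"
  shows "\<exists>J. (\<forall>i\<in>I. Q i (J i) \<and> length (J i) \<le> k) \<and>
    (\<forall>i\<in>I. \<forall>j\<in>I. i \<noteq> j \<longrightarrow> set (J i) \<inter> set (J j) = {})"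
proof -
  have "\<exists>J. (\<forall>i\<in>I'. Q i (J i) \<and> length (J i) \<le> k) \<and>
    (\<forall>i\<in>I'. \<forall>j\<in>I'. i \<noteq> j \<longrightarrow> set (J i) \<inter> set (J j) = {})" if "I' \<subseteq> I" for I'
    using finite_subset[OF that assms(1)] that
  proof (induction I' rule: finite_induct)
    case (insert i I')
    then obtain J where J: "\<forall>i\<in>I'. Q i (J i) \<and> length (J i) \<le> k"
      "\<forall>i\<in>I'. \<forall>j\<in>I'. i \<noteq> j \<longrightarrow> set (J i) \<inter> set (J j) = {}" by auto
    let ?Z = "\<Union>j\<in>I'. set (J j)"
    have "card ?Z \<le> (\<Sum>j\<in>I'. card (set (J j)))" using insert(1) by (rule card_UN_le)
    also have "\<dots> \<le> (\<Sum>j\<in>I'. k)" using J(1) card_length le_trans by (intro sum_mono) blast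
    also have "\<dots> \<le> k * card I" using insert.prems card_mono[OF assms(1), of I'] by simp
    finally obtain l where l: "Q i l" "length l \<le> k" "set l \<inter> ?Z = {}"
      using step[of i ?Z] insert(1) insert.prems by auto
    show ?case
    proof (intro exI[of _ "J(i := l)"] conjI ballI impI)
      fix a assume "a \<in> insert i I'"
      then show "Q a ((J(i := l)) a)" "length ((J(i := l)) a) \<le> k" using J(1) l by auto
    next
      fix a b assume "a \<in> insert i I'" "b \<in> insert i I'" "a \<noteq> b"
      then show "set ((J(i := l)) a) \<inter> set ((J(i := l)) b) = {}"
        using J(2) l(3) insert(2) by (cases "a = i"; cases "b = i") (simp_all, blast+)
    qed
  qed simp
  then show ?thesis by blast
qed

text \<open>The threshold \<open>2 * m\<close> leaves \<open>m\<close> hubs to choose from when the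
  heads of \<open>m\<close> linkage paths have taken up to \<open>m\<close> hubs.\<close>

definition weak_vertices :: "'a set \<Rightarrow> ('a \<times> 'a) set \<Rightarrow> 'a set \<Rightarrow> nat \<Rightarrow> 'a set" where
  "weak_vertices V E X m = {v \<in> V - X. card (E `` {v} \<inter> X) < 2 * m}"

text \<open>The hubs minimise \<open>card (M x)\<close>, with \<open>t\<close> as threshold.
  \<open>escape\<close> is then applied twice: to \<open>M v - X\<close>, whose outside dominates
  \<open>v\<close>, for the routes into the hub \<open>v\<close>, and to the weak set. The constants
  \<open>1310 * m ^ 2\<close> and \<open>166 * m ^ 3\<close> are those needed when the weak
  stretches and the vertices after them are chosen.\<close>

lemma (in semicomplete_arcs) hub_system:
  assumes E: "E \<subseteq> V \<times> V" and R: "R \<subseteq> V" "card R \<le> 2 * m" and m: "0 < m"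
    and deg: "\<forall>v\<in>V. d \<le> card (E `` {v})"
    and d: "12000 * m ^ 3 \<le> d"
    and V: "V \<noteq> {}"
  shows "\<exists>X J. X \<subseteq> V - R \<and> card X = 20 * m \<and> hub_routes E X (V - R - X) J \<and>
    (\<forall>s\<in>V. \<forall>Z. finite Z \<longrightarrow> card Z \<le> 1310 * m ^ 2 \<longrightarrow> (\<exists>ys. length ys \<le> 2 \<and>
       set ys \<subseteq> weak_vertices (V - R) E X m - Z \<and> distinct ys \<and> successively (\<lambda>x y. (x, y) \<in> E) (s # ys) \<and>
       166 * m ^ 3 \<le> card (E `` {last (s # ys)} - weak_vertices (V - R) E X m - Z)))"
proof -
  define M where "M v = {w \<in> V - R. w \<noteq> v \<and> (w, v) \<notin> E}" for v
  have m3: "m \<le> m ^ 2" "m ^ 2 \<le> m ^ 3" using m by (simp_all add: power2_eq_square power3_eq_cube)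
  have finE: "finite (E `` {v})" for v using E finV by (rule_tac finite_subset[of _ V]) auto
  have "d \<le> card V"
  proof -
    obtain v where "v \<in> V" using V by auto
    moreover have "card (E `` {v}) \<le> card V" using E finV by (intro card_mono) auto
    ultimately show ?thesis using deg by (meson le_trans)
  qed
  then have "20 * m \<le> card (V - R)"
    using d m3 R finV finite_subset[OF R(1)] by (simp add: card_Diff_subset)
  then obtain X t where X: "X \<subseteq> V - R" "card X = 20 * m" "\<And>x. x \<in> X \<Longrightarrow> card (M x) \<le> t"
    and t: "\<And>v. v \<in> V - R - X \<Longrightarrow> t \<le> card (M v)"
    using ex_smallest_subset[OF finite_Diff[OF finV], of "20 * m" R "\<lambda>v. card (M v)"] by metis
  have finX: "finite X" "finite R" using X(1) R(1) finV finite_subset by (metis finite_Diff)+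
  have finM: "finite (M v)" for v using finV unfolding M_def by auto
  have esc: "\<exists>ys. length ys \<le> 2 \<and> set ys \<subseteq> F - Z \<and> distinct ys \<and>
    successively (\<lambda>x y. (x, y) \<in> E) (s # ys) \<and> K \<le> card (E `` {last (s # ys)} - F - Z)"
    if F: "F \<subseteq> V - R - X" "9 * card F \<le> 10 * t" and s: "s \<in> V" and Z: "finite Z" "8 * (K + card Z) \<le> d" "0 < K" for F s Z K
  proof (rule escape[where M = M and t = t and d = d])
    show "finite F" using F(1) finV finite_subset by (metis finite_Diff)
    show "M v \<subseteq> E `` {v}" if "v \<in> F" for v
      using that F(1) total unfolding M_def by auto
    show "v \<notin> M w" if "v \<in> F" "w \<in> F" "w \<in> M v" for v w
      using that F(1) total unfolding M_def by blast
    show "t \<le> card (M v)" if "v \<in> F" for v using t that F(1) by blast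
    show "d \<le> card (E `` {v})" if "v \<in> insert s F" for v using deg that F(1) s by blast
  qed (use F Z finE in auto)
  let ?I = "{(u, v) \<in> X \<times> X. u \<noteq> v}"
  have finI: "finite ?I" by (rule finite_subset[of _ "X \<times> X"]) (use finX in auto)
  have cI: "card ?I \<le> 400 * m ^ 2"
  proof -
    have "card ?I \<le> card (X \<times> X)" using finX by (intro card_mono) auto
    then show ?thesis using X(2) by (simp add: card_cartesian_product power2_eq_square)
  qed
  define Q where "Q = (\<lambda>(u, v) l. l \<noteq> [] \<and> distinct l \<and> set l \<subseteq> V - R - X \<and>
    successively (\<lambda>x y. (x, y) \<in> E) (u # l @ [v]))"
  have "\<exists>J. (\<forall>i\<in>?I. Q i (J i) \<and> length (J i) \<le> 3) \<and>
    (\<forall>i\<in>?I. \<forall>j\<in>?I. i \<noteq> j \<longrightarrow> set (J i) \<inter> set (J j) = {})"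
  proof (rule greedy_disjoint_lists[OF finI])
    fix i and Z :: "'a set" assume i: "i \<in> ?I" and Z: "finite Z" "card Z \<le> 3 * card ?I"
    obtain u v where uv: "i = (u, v)" "u \<in> X" "v \<in> X" using i by auto
    let ?F = "M v - X" and ?Z = "Z \<union> R \<union> X"
    have "card ?F \<le> card (M v)" using finM by (intro card_mono) auto
    then have F: "9 * card ?F \<le> 10 * t" using X(3)[OF uv(3)] by linarith
    have "card ?Z \<le> card Z + card R + card X" using card_Un_le[of "Z \<union> R" X] card_Un_le[of Z R] by linarith
    \<comment> \<open>Here 1222 is 3 * 400 for earlier routes, plus 2 for \<open>R\<close> and 20
      for \<open>X\<close>.\<close>
    then have "card ?Z \<le> 1222 * m ^ 2" using Z(2) cI R(2) X(2) m3(1) by linarith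
    moreover have "1 \<le> m ^ 2" using m by simp
    ultimately have "8 * card ?Z + 8 \<le> d" using d m3 by linarith
    then have "8 * (1 + card ?Z) \<le> d" by simp
    moreover have "?F \<subseteq> V - R - X" unfolding M_def by auto
    ultimately obtain ys where ys: "length ys \<le> 2" "set ys \<subseteq> ?F - ?Z" "distinct ys"
      "successively (\<lambda>x y. (x, y) \<in> E) (u # ys)" "1 \<le> card (E `` {last (u # ys)} - ?F - ?Z)"
      using esc[of ?F u ?Z 1] F uv X(1) Z(1) finX by auto
    have "E `` {last (u # ys)} - ?F - ?Z \<noteq> {}" using ys(5) by (metis card.empty not_one_le_zero)
    \<comment> \<open>Being outside \<open>M v\<close>, the vertex \<open>z\<close> sends an arc to
      \<open>v\<close> and can close the route.\<close>
    then obtain z where z: "(last (u # ys), z) \<in> E" "z \<notin> ?F" "z \<notin> ?Z" by blast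
    have "z \<in> V" "z \<noteq> v" using z E uv by auto
    then have "(z, v) \<in> E" using z unfolding M_def by auto
    then have "successively (\<lambda>x y. (x, y) \<in> E) ((u # ys) @ [z, v])"
      using ys(4) z(1) unfolding successively_append_iff[of _ "u # ys"] by simp
    moreover have "distinct (ys @ [z])" "set (ys @ [z]) \<subseteq> V - R - X"
      using ys(2,3) z(2,3) \<open>z \<in> V\<close> unfolding M_def by auto
    ultimately have "Q i (ys @ [z])" using uv(1) unfolding Q_def by simp
    then show "\<exists>l. Q i l \<and> length l \<le> 3 \<and> set l \<inter> Z = {}"
      using ys z by (intro exI[of _ "ys @ [z]"]) auto
  qed
  then obtain J where J: "\<And>i. i \<in> ?I \<Longrightarrow> Q i (J i) \<and> length (J i) \<le> 3"
    "\<And>i j. i \<in> ?I \<Longrightarrow> j \<in> ?I \<Longrightarrow> i \<noteq> j \<Longrightarrow> set (J i) \<inter> set (J j) = {}" by blast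
  have "hub_routes E X (V - R - X) J"
    unfolding hub_routes_def
  proof (intro conjI ballI impI)
    fix u v assume "u \<in> X" "v \<in> X" "u \<noteq> v"
    then have "Q (u, v) (J (u, v)) \<and> length (J (u, v)) \<le> 3" using J(1)[of "(u, v)"] by auto
    then show "J (u, v) \<noteq> []" "length (J (u, v)) \<le> 3" "distinct (J (u, v))" "set (J (u, v)) \<subseteq> V - R - X"
      "successively (\<lambda>x y. (x, y) \<in> E) (u # J (u, v) @ [v])" unfolding Q_def by auto
  next
    fix u v u' v' assume "u \<in> X" "v \<in> X" "u' \<in> X" "v' \<in> X" "u \<noteq> v" "u' \<noteq> v'" "(u, v) \<noteq> (u', v')"
    then show "set (J (u, v)) \<inter> set (J (u', v')) = {}" using J(2)[of "(u, v)" "(u', v')"] by auto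
  qed
  moreover
  let ?W = "weak_vertices (V - R) E X m"
  have finW: "finite ?W" unfolding weak_vertices_def using finV by auto
  have W: "?W \<subseteq> V - R - X" unfolding weak_vertices_def by auto
  have "9 * card ?W \<le> 10 * t"
  proof -
    let ?P = "SIGMA w:?W. {x \<in> X. w \<in> M x}"
    \<comment> \<open>A weak vertex dominates fewer than \<open>2 * m\<close> of the
      \<open>20 * m\<close> hubs. Counting the pairs \<open>w \<in> M x\<close> from both sides
      gives the ratio 20/18 = 10/9.\<close>
    have "18 * m \<le> card {x \<in> X. w \<in> M x}" if w: "w \<in> ?W" for w
    proof -
      have "X \<subseteq> (E `` {w} \<inter> X) \<union> {x \<in> X. w \<in> M x}" using w W unfolding M_def by auto
      then have "card X \<le> card ((E `` {w} \<inter> X) \<union> {x \<in> X. w \<in> M x})" using finX by (intro card_mono) auto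
      also have "\<dots> \<le> card (E `` {w} \<inter> X) + card {x \<in> X. w \<in> M x}" by (rule card_Un_le)
      also have "card (E `` {w} \<inter> X) < 2 * m" using w unfolding weak_vertices_def by auto
      finally show ?thesis using X(2) by linarith
    qed
    then have "card ?W * (18 * m) \<le> (\<Sum>w\<in>?W. card {x \<in> X. w \<in> M x})"
      using sum_bounded_below[of ?W "18 * m" "\<lambda>w. card {x \<in> X. w \<in> M x}"] by simp
    also have "\<dots> = card ?P" using finW finX by simp
    also have "\<dots> = card (?P\<inverse>)" by simp
    also have "\<dots> \<le> card (SIGMA x:X. M x)" using finX finM by (intro card_mono) auto
    also have "\<dots> = (\<Sum>x\<in>X. card (M x))" using finX finM by simp
    also have "\<dots> \<le> card X * t" using sum_bounded_above[of X "\<lambda>x. card (M x)" t] X(3) by simp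
    finally have "m * (9 * card ?W) \<le> m * (10 * t)" using X(2) by simp
    then show ?thesis using m by simp
  qed
  then have "\<exists>ys. length ys \<le> 2 \<and> set ys \<subseteq> ?W - Z \<and> distinct ys \<and>
      successively (\<lambda>x y. (x, y) \<in> E) (s # ys) \<and> 166 * m ^ 3 \<le> card (E `` {last (s # ys)} - ?W - Z)"
    if "s \<in> V" "finite Z" "card Z \<le> 1310 * m ^ 2" for s Z
  proof -
    \<comment> \<open>8 * 166 + 8 * 1310 = 11808, which is below 12000.\<close>
    have "1328 * m ^ 3 + 8 * card Z \<le> d" using that(3) d m3 by linarith
    then have "8 * (166 * m ^ 3 + card Z) \<le> d" by simp
    then show ?thesis using esc[OF W _ that(1,2)] \<open>9 * card ?W \<le> 10 * t\<close> m by simp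
  qed
  ultimately show ?thesis using X(1,2) by blast
qed

subsection \<open>Linkages avoiding a scattered set\<close>

text \<open>
  A target that has to be reached by several paths is replaced by one copy for each of them.
\<close>

definition slot_arcs ::
  "('a \<times> 'a) set \<Rightarrow> 'a set \<Rightarrow> 'i set \<Rightarrow> ('i \<Rightarrow> 'a) \<Rightarrow> (('a + 'i) \<times> ('a + 'i)) set" where
  "slot_arcs E U I tgt = {(Inl a, Inl b) | a b. a \<in> U \<and> b \<in> U \<and> (a, b) \<in> E} \<union>
     {(Inl a, Inr e) | a e. a \<in> U \<and> e \<in> I \<and> (a, tgt e) \<in> E}"

text \<open>Slots have no outgoing arcs, so a slot can only be the last entry of a path.\<close>

lemma path_between_slot:
  assumes p: "path_between (slot_arcs E U I tgt) (Inl ` X) (Inr e) p"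
  shows "\<exists>q. p = map Inl q @ [Inr e] \<and> q \<noteq> [] \<and> distinct q \<and> set q \<subseteq> U \<and>
    successively (\<lambda>x y. (x, y) \<in> E) q \<and> hd q \<in> X \<and> (last q, tgt e) \<in> E"
proof -
  define E' where "E' = slot_arcs E U I tgt"
  note E'_def = E'_def slot_arcs_def
  have p': "p \<noteq> []" "distinct p" "successively (\<lambda>x y. (x, y) \<in> E') p" "hd p \<in> Inl ` X" "last p = Inr e"
    using p unfolding path_between_def E'_def(1) by auto
  have tails: "x \<in> Inl ` U" if "x \<in> set (butlast l)" "successively (\<lambda>x y. (x, y) \<in> E') l" for x l
    using that
  proof (induction l)
    case (Cons a l)
    then show ?case by (cases l) (auto simp: E'_def split: if_splits)
  qed simp
  define q where "q = map projl (butlast p)"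
  have "butlast p = map Inl q"
    unfolding q_def map_map
    by (rule map_idI[symmetric]) (use tails[OF _ p'(3)] in force)
  then have peq: "p = map Inl q @ [Inr e]" using p'(1,5) by (metis append_butlast_last_id)
  have ne: "q \<noteq> []" using peq p'(4) by auto
  have "set q \<subseteq> U" using tails[OF _ p'(3)] peq by force
  moreover have "distinct q" using p'(2) peq by (simp add: distinct_map)
  moreover have "hd q \<in> X" using p'(4) peq ne by (auto simp: hd_map)
  moreover have q: "successively (\<lambda>x y. (Inl x, Inl y) \<in> E') q" "(Inl (last q), Inr e) \<in> E'"
    using p'(3) peq ne by (auto simp: successively_append_iff successively_map last_map)
  have "successively (\<lambda>x y. (x, y) \<in> E) q"
    using q(1) by (rule successively_mono) (auto simp: E'_def)
  moreover have "(last q, tgt e) \<in> E" using q(2) unfolding E'_def by auto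
  ultimately show ?thesis using peq ne by blast
qed

text \<open>Menger's theorem in the slot digraph. A separator there consists of vertices
  \<open>C\<close> and slots \<open>J\<close>, and \<open>sep\<close> rules out small ones in terms
  of the original digraph, with \<open>A\<close> as the closed side of the remaining hubs.\<close>

lemma linkage_into_slots:
  fixes E :: "('a \<times> 'a) set" and I :: "'i set"
  assumes fin: "finite U" "finite X" "finite I"
    and sep: "\<And>C J A. C \<subseteq> U \<Longrightarrow> J \<subseteq> I \<Longrightarrow> card C + card J < card I \<Longrightarrow> A \<subseteq> U - C \<Longrightarrow> X - C \<subseteq> A \<Longrightarrow>
      E `` A \<inter> U \<subseteq> A \<union> C \<Longrightarrow> (\<And>e. e \<in> I - J \<Longrightarrow> tgt e \<notin> E `` A) \<Longrightarrow> False"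
    and XU: "X \<subseteq> U"
  shows "\<exists>P. linkage E U X I tgt P"
proof -
  define E' where "E' = slot_arcs E U I tgt"
  note E'_def = E'_def slot_arcs_def
  have "E' \<subseteq> (Inl ` U \<union> Inr ` I) \<times> (Inl ` U \<union> Inr ` I)" unfolding E'_def by auto
  then have finE: "finite E'" using fin by (meson finite_SigmaI finite_UnI finite_imageI finite_subset)
  have "card I \<le> card S" if S: "finite S" "separates E' (Inl ` X) (Inr ` I) S" for S
  proof (rule ccontr)
    assume small: "\<not> card I \<le> card S"
    obtain T where T: "Inl ` X \<subseteq> T \<union> S" "T \<inter> S = {}" "T \<inter> Inr ` I = {}" "E' `` T \<subseteq> T \<union> S"
      using S(2) unfolding separates_def by (elim exE conjE) rule
    let ?C = "{a \<in> U. Inl a \<in> S}" and ?J = "{e \<in> I. Inr e \<in> S}" and ?A = "{a \<in> U. Inl a \<in> T}"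
    have "card ?C + card ?J = card (Inl ` ?C :: ('a + 'i) set) + card (Inr ` ?J :: ('a + 'i) set)"
      by (simp add: card_image)
    also have "\<dots> = card (Inl ` ?C \<union> Inr ` ?J)" using fin by (intro card_Un_disjoint[symmetric]) auto
    also have "\<dots> \<le> card S" using S(1) by (intro card_mono) auto
    finally have "card ?C + card ?J < card I" using small by simp
    moreover have "?A \<subseteq> U - ?C" using T(2) by auto
    moreover have "X - ?C \<subseteq> ?A" using T(1) XU by blast
    moreover have "E `` ?A \<inter> U \<subseteq> ?A \<union> ?C"
    proof
      fix w assume "w \<in> E `` ?A \<inter> U"
      then have "Inl w \<in> E' `` T" "w \<in> U" unfolding E'_def by blast+
      then show "w \<in> ?A \<union> ?C" using T(4) by blast
    qed
    moreover have "tgt e \<notin> E `` ?A" if e: "e \<in> I - ?J" for e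
    proof
      assume "tgt e \<in> E `` ?A"
      then have "Inr e \<in> E' `` T" using e unfolding E'_def by blast
      then show False using T(3,4) e by blast
    qed
    ultimately show False using sep[of ?C ?J ?A] by blast
  qed
  then obtain K p where K: "K \<subseteq> Inr ` I" "card K = card I"
    and p: "\<forall>b\<in>K. path_between E' (Inl ` X) b (p b)"
    and dis: "\<forall>b\<in>K. \<forall>b'\<in>K. b \<noteq> b' \<longrightarrow> set (p b) \<inter> set (p b') = {}"
    using menger[OF finE, of "Inl ` X" "Inr ` I" "card I"] fin by auto
  have "K = Inr ` I" using K fin by (intro card_subset_eq) (auto simp: card_image)
  then have pth: "path_between (slot_arcs E U I tgt) (Inl ` X) (Inr e) (p (Inr e))" if "e \<in> I" for e
    using p that unfolding E'_def(1) by simp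
  have "\<exists>q. p (Inr e) = map Inl q @ [Inr e] \<and> q \<noteq> [] \<and> distinct q \<and> set q \<subseteq> U \<and>
    successively (\<lambda>x y. (x, y) \<in> E) q \<and> hd q \<in> X \<and> (last q, tgt e) \<in> E" if "e \<in> I" for e
    using path_between_slot[OF pth[OF that]] .
  then obtain P where P: "\<And>e. e \<in> I \<Longrightarrow> p (Inr e) = map Inl (P e) @ [Inr e] \<and> P e \<noteq> [] \<and> distinct (P e) \<and> set (P e) \<subseteq> U \<and>
    successively (\<lambda>x y. (x, y) \<in> E) (P e) \<and> hd (P e) \<in> X \<and> (last (P e), tgt e) \<in> E"
    by metis
  have "set (P e) \<inter> set (P e') = {}" if "e \<in> I" "e' \<in> I" "e \<noteq> e'" for e e'
  proof -
    have "set (p (Inr e)) \<inter> set (p (Inr e')) = {}" using dis that \<open>K = Inr ` I\<close> by blast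
    moreover have "Inl ` set (P e) \<subseteq> set (p (Inr e))" "Inl ` set (P e') \<subseteq> set (p (Inr e'))" using P that by auto
    ultimately show ?thesis by blast
  qed
  then show ?thesis using P unfolding linkage_def by blast
qed

lemma t_connectedD:
  assumes "t_connected t V E" "S \<subseteq> V" "card S < t" "x \<in> V - S" "y \<in> V - S" "x \<noteq> y"
  shows "\<exists>p. p \<noteq> [] \<and> hd p = x \<and> last p = y \<and> set p \<subseteq> V - S \<and> successively (\<lambda>x y. (x, y) \<in> E) p"
proof -
  have "card S \<le> t - 1" using assms(3) by simp
  then obtain p where "dpath V E p x y" "set p \<inter> S = {}" using assms unfolding t_connected_def by blast
  then show ?thesis unfolding dpath_def successively_conv_nth by blast
qed

text \<open>Suppose that \<open>C\<close> and \<open>J\<close> form a separator that is too small.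
  Among the subsets of \<open>Y\<close> whose deletion along with it still separates, a smallest one
  \<open>Y'\<close> consists of vertices crossing one common near cut, so \<open>Y'\<close> has at
  most one element. With the images of the sources this gives a separator of at most
  \<open>card S + card AH\<close> vertices, against the connectivity.\<close>

lemma linkage_avoiding_scattered:
  fixes E :: "('a \<times> 'a) set" and AH :: "('b \<times> 'b) set"
  assumes finV: "finite V"
    and H: "finite VH" "AH \<subseteq> VH \<times> VH" and f: "inj_on f VH" "f ` VH \<subseteq> V"
    and conn: "t_connected (card {v \<in> VH. indeg AH v = 0} + card AH + 1) V E"
    and X: "X \<subseteq> V - f ` VH" "card AH \<le> card X"
    and Y: "Y \<subseteq> V - f ` VH - X" "card Y \<le> 3 * card AH"
    and scattered: "\<And>A B y y'. near_cut (V - f ` {v \<in> VH. indeg AH v = 0}) E (4 * card AH) A B \<Longrightarrow> X \<inter> B = {} \<Longrightarrow>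
      y \<in> Y \<Longrightarrow> y' \<in> Y \<Longrightarrow> crosses (V - f ` {v \<in> VH. indeg AH v = 0}) E A B y \<Longrightarrow>
      crosses (V - f ` {v \<in> VH. indeg AH v = 0}) E A B y' \<Longrightarrow> y = y'"
  shows "\<exists>P. linkage E (V - f ` VH - Y) X AH (\<lambda>e. f (snd e)) P"
proof (rule linkage_into_slots)
  define R where "R = f ` VH"
  define S where "S = f ` {v \<in> VH. indeg AH v = 0}"
  define V' where "V' = V - S"
  have finAH: "finite AH" using H by (meson finite_SigmaI finite_subset)
  have finX: "finite X" "finite Y" using finV X Y by (meson finite_Diff finite_subset)+
  show "finite (V - f ` VH - Y)" "finite X" "finite AH" using finV finX finAH by auto
  show "X \<subseteq> V - f ` VH - Y" using X Y by auto
  fix C J A1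
  assume C: "C \<subseteq> V - f ` VH - Y" and J: "J \<subseteq> AH" and small: "card C + card J < card AH"
    and A1: "A1 \<subseteq> V - f ` VH - Y - C" "X - C \<subseteq> A1" "E `` A1 \<inter> (V - f ` VH - Y) \<subseteq> A1 \<union> C"
    and A1T: "\<And>e. e \<in> AH - J \<Longrightarrow> f (snd e) \<notin> E `` A1"
  define T where "T = (\<lambda>e. f (snd e)) ` (AH - J)"
  \<comment> \<open>Every arc into such a vertex has its slot in \<open>J\<close>, so
    \<open>T2\<close> is at most as large as \<open>J\<close> and \<open>Q0\<close> has fewer than
    \<open>card AH\<close> vertices.\<close>
  define T2 where "T2 = R - S - T"
  define Q0 where "Q0 = C \<union> T2"
  have RV: "R \<subseteq> V" "S \<subseteq> R" "T \<subseteq> R" using f(2) H(2) unfolding R_def S_def T_def by auto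
  have T2J: "T2 \<subseteq> (\<lambda>e. f (snd e)) ` J"
  proof
    fix r assume r: "r \<in> T2"
    then obtain v where v: "v \<in> VH" "r = f v" "indeg AH v \<noteq> 0" unfolding T2_def R_def S_def by auto
    have "{u. (u, v) \<in> AH} \<noteq> {}" using v(3) unfolding indeg_def by (metis card.empty)
    then obtain u where "(u, v) \<in> AH" by blast
    then show "r \<in> (\<lambda>e. f (snd e)) ` J" using r v(2) unfolding T2_def T_def by force
  qed
  have finJ: "finite J" using J finAH finite_subset by auto
  have finC: "finite C" using C finV by (meson finite_Diff finite_subset)
  have finQ0: "finite Q0" using finC T2J finJ unfolding Q0_def by (meson finite_UnI finite_imageI finite_subset)
  have "card T2 \<le> card J" using T2J finJ by (meson card_image_le card_mono finite_imageI le_trans)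
  then have cQ0: "card Q0 < card AH" using small card_Un_le[of C T2] unfolding Q0_def by linarith
  have ST: "S \<inter> T = {}"
  proof -
    have ne: "v \<noteq> snd e" if "e \<in> AH" "v \<in> VH" "indeg AH v = 0" for v e
    proof
      assume "v = snd e"
      then have "fst e \<in> {u. (u, v) \<in> AH}" using that(1) by simp
      moreover have "finite {u. (u, v) \<in> AH}"
        by (rule finite_subset[OF _ H(1)]) (use H(2) in auto)
      ultimately show False using that(3) unfolding indeg_def by auto
    qed
    have "f v \<noteq> f (snd e)" if "e \<in> AH" "v \<in> VH" "indeg AH v = 0" for v e
      using ne[OF that] inj_onD[OF f(1), of v "snd e"] that H(2) by auto
    then show ?thesis unfolding S_def T_def by blast
  qed
  \<comment> \<open>In \<open>V'\<close> the set \<open>Q0 \<union> Y'\<close> separates the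
    remaining hubs, on side \<open>A\<close>, from the remaining targets \<open>T\<close>.\<close>
  define good where "good Y' A \<longleftrightarrow> X - C \<subseteq> A \<and> A \<subseteq> V' - Q0 - Y' \<and> E `` A \<inter> (V' - Q0 - Y') \<subseteq> A \<and> A \<inter> T = {}" for Y' A
  have "good Y A1"
    unfolding good_def
  proof (intro conjI)
    show "X - C \<subseteq> A1" by (rule A1(2))
    show "A1 \<subseteq> V' - Q0 - Y" using A1(1) RV unfolding V'_def Q0_def T2_def R_def by auto
    show "A1 \<inter> T = {}" using A1(1) RV unfolding R_def by auto
    show "E `` A1 \<inter> (V' - Q0 - Y) \<subseteq> A1"
    proof
      fix w assume w: "w \<in> E `` A1 \<inter> (V' - Q0 - Y)"
      have "w \<notin> T" using A1T w unfolding T_def by blast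
      then have "w \<notin> R" using w unfolding V'_def Q0_def T2_def by auto
      then show "w \<in> A1" using w A1(3) unfolding R_def V'_def Q0_def by blast
    qed
  qed
  define feasible where "feasible Z \<longleftrightarrow> Z \<subseteq> Y \<and> (\<exists>A. good Z A)" for Z
  have "feasible Y" using \<open>good Y A1\<close> unfolding feasible_def by blast
  then obtain Y' where feas: "feasible Y'" and least: "\<And>Z. feasible Z \<Longrightarrow> card Y' \<le> card Z"
    using ex_has_least_nat[of feasible Y card] by auto
  have Y': "Y' \<subseteq> Y" using feas unfolding feasible_def by blast
  obtain A where A: "good Y' A" using feas unfolding feasible_def by blast
  have min: "card Y' \<le> card Z" if "Z \<subseteq> Y" "good Z A'" for Z A'
    using least[of Z] that unfolding feasible_def by blast
  define B where "B = V' - Q0 - Y' - A"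
  have finY': "finite Y'" using Y' finX finite_subset by auto
  have Ysep: "Y' \<inter> R = {}" "Y' \<inter> Q0 = {}" "Y' \<subseteq> V'" "Y' \<inter> X = {}"
    using Y' Y(1) C RV unfolding Q0_def T2_def R_def V'_def by auto
  have sepAB: "V' - A - B \<subseteq> Q0 \<union> Y'" unfolding B_def by auto
  have nc: "near_cut V' E (4 * card AH) A B"
    unfolding near_cut_def
  proof (intro conjI)
    have "card (V' - A - B) \<le> card (Q0 \<union> Y')" using sepAB finQ0 finY' by (intro card_mono) auto
    also have "\<dots> \<le> card Q0 + card Y'" by (rule card_Un_le)
    also have "card Y' \<le> card Y" using Y' finX by (intro card_mono) auto
    finally show "card (V' - A - B) \<le> 4 * card AH" using cQ0 Y(2) by linarith
    show "\<forall>x\<in>A. \<forall>y\<in>B. (x, y) \<notin> E" using A unfolding good_def B_def by blast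
  qed (use A in \<open>auto simp: good_def B_def\<close>)
  have XB: "X \<inter> B = {}" using A unfolding good_def B_def Q0_def by blast
  have cross: "crosses V' E A B y" if y: "y \<in> Y'" for y
  proof -
    have less: "card (Y' - {y}) < card Y'" "Y' - {y} \<subseteq> Y" using card_Diff1_less[OF finY' y] Y' by blast+
    \<comment> \<open>If there were no such arc, \<open>y\<close> could move to the second side; if
      \<open>y\<close> had no arc into \<open>B\<close>, it could join \<open>A\<close>. Either
      contradicts the minimality of \<open>Y'\<close>.\<close>
    have "\<exists>a\<in>A. (a, y) \<in> E"
    proof (rule ccontr)
      assume no: "\<not> ?thesis"
      have "good (Y' - {y}) A"
        unfolding good_def
      proof (intro conjI)
        show "E `` A \<inter> (V' - Q0 - (Y' - {y})) \<subseteq> A"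
          using A no unfolding good_def by blast
      qed (use A in \<open>auto simp: good_def\<close>)
      then show False using min[OF less(2)] less(1) by (meson not_le)
    qed
    moreover have "\<exists>c\<in>B. (y, c) \<in> E"
    proof (rule ccontr)
      assume no: "\<not> ?thesis"
      have "good (Y' - {y}) (insert y A)"
        unfolding good_def
      proof (intro conjI)
        show "E `` insert y A \<inter> (V' - Q0 - (Y' - {y})) \<subseteq> insert y A"
          using A no unfolding good_def B_def by blast
        show "insert y A \<subseteq> V' - Q0 - (Y' - {y})" using A y Ysep unfolding good_def by blast
        show "insert y A \<inter> T = {}" using A y Ysep(1) RV(3) unfolding good_def by blast
        show "X - C \<subseteq> insert y A" using A unfolding good_def by blast
      qed
      then show False using min[OF less(2)] less(1) by (meson not_le)
    qed
    moreover have "y \<in> V' - A - B" using y A Ysep unfolding good_def B_def by blast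
    ultimately show ?thesis unfolding crosses_def by blast
  qed
  have "y = y'" if "y \<in> Y'" "y' \<in> Y'" for y y'
    using scattered[of A B y y'] nc XB that Y' cross[OF that(1)] cross[OF that(2)] unfolding V'_def S_def by blast
  then have "card Y' \<le> 1" using card_le_Suc0_iff_eq[OF finY'] by auto
  let ?D = "S \<union> Q0 \<union> Y'"
  have "card S \<le> card {v \<in> VH. indeg AH v = 0}" unfolding S_def using H(1) by (intro card_image_le) auto
  then have cD: "card ?D < card {v \<in> VH. indeg AH v = 0} + card AH + 1"
    using cQ0 \<open>card Y' \<le> 1\<close> card_Un_le[of "S \<union> Q0" Y'] card_Un_le[of S Q0] by linarith
  have DV: "?D \<subseteq> V" using RV C Y' Y(1) unfolding Q0_def T2_def by auto
  have "\<not> X \<subseteq> C"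
  proof
    assume "X \<subseteq> C"
    then have "card X \<le> card C" using finC by (rule card_mono[rotated])
    then show False using small X(2) by linarith
  qed
  then obtain x where x: "x \<in> X" "x \<notin> C" by blast
  have "AH - J \<noteq> {}"
  proof
    assume "AH - J = {}"
    then have "card AH \<le> card J" using finJ by (intro card_mono) auto
    then show False using small by linarith
  qed
  then obtain t where t: "t \<in> T" unfolding T_def by blast
  have xA: "x \<in> A" using x A unfolding good_def by blast
  have "x \<in> V - ?D" using xA A DV unfolding good_def V'_def by blast
  moreover have "t \<in> V - ?D"
  proof -
    have "t \<in> R" using t RV(3) by (rule subsetD[rotated])
    then have "t \<in> V" "t \<notin> C" "t \<notin> Y'" using RV(1) C Ysep(1) unfolding R_def by auto
    moreover have "t \<notin> S" "t \<notin> T2" using t ST unfolding T2_def by auto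
    ultimately show ?thesis unfolding Q0_def by simp
  qed
  moreover have "x \<noteq> t" using xA A t unfolding good_def by blast
  ultimately obtain p where p: "p \<noteq> []" "hd p = x" "last p = t" "set p \<subseteq> V - ?D" "successively (\<lambda>x y. (x, y) \<in> E) p"
    using t_connectedD[OF conn DV cD] by blast
  have "set p \<subseteq> A"
  proof (rule successively_stays[OF p(5,1)])
    show "hd p \<in> A" using p(2) xA by simp
    fix v w assume "v \<in> A" "(v, w) \<in> E" "w \<in> set p"
    then show "w \<in> A" using A p(4) unfolding good_def V'_def by blast
  qed
  then show False using p(1,3) t A unfolding good_def by (metis disjoint_iff last_in_set subsetD)
qed

subsection \<open>Subdivisions\<close>

lemma internal_Cons_snoc: "internal (x # p @ [y]) = set p"
  unfolding internal_def by simp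

lemma dpath_Cons_snoc:
  assumes "successively (\<lambda>x y. (x, y) \<in> A) (x # p @ [y])" "distinct p" "set p \<subseteq> V" "x \<in> V" "y \<in> V"
    "x \<notin> set p" "y \<notin> set p" "x \<noteq> y"
  shows "dpath V A (x # p @ [y]) x y"
  using assms unfolding dpath_def successively_conv_nth by auto

lemma card_UN_set_le:
  assumes "finite I" "\<And>i. i \<in> I \<Longrightarrow> length (l i) \<le> k"
  shows "card (\<Union>i\<in>I. set (l i)) \<le> k * card I"
proof -
  have "card (\<Union>i\<in>I. set (l i)) \<le> (\<Sum>i\<in>I. card (set (l i)))" using assms(1) by (rule card_UN_le)
  also have "\<dots> \<le> (\<Sum>i\<in>I. k)" using assms(2) card_length le_trans by (intro sum_mono) blast
  finally show ?thesis by (simp add: mult.commute)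
qed

text \<open>Without isolated vertices, every vertex is an end of some arc.\<close>

lemma card_vertices_le:
  assumes "simple_digraph VH AH" "min_total_degree_ge1 VH AH"
  shows "card VH \<le> 2 * card AH"
proof -
  have fin: "finite VH" "AH \<subseteq> VH \<times> VH" using assms(1) unfolding simple_digraph_def by auto
  then have finA: "finite AH" by (meson finite_SigmaI finite_subset)
  have "VH \<subseteq> fst ` AH \<union> snd ` AH"
  proof
    fix v assume "v \<in> VH"
    then have "outdeg AH v \<noteq> 0 \<or> indeg AH v \<noteq> 0" using assms(2) unfolding min_total_degree_ge1_def by force
    then have "{w. (v, w) \<in> AH} \<noteq> {} \<or> {u. (u, v) \<in> AH} \<noteq> {}" unfolding outdeg_def indeg_def by (metis card.empty)
    then show "v \<in> fst ` AH \<union> snd ` AH" by force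
  qed
  then have "card VH \<le> card (fst ` AH \<union> snd ` AH)" using finA by (intro card_mono) auto
  also have "\<dots> \<le> card (fst ` AH) + card (snd ` AH)" by (rule card_Un_le)
  also have "\<dots> \<le> 2 * card AH" using card_image_le[OF finA, of fst] card_image_le[OF finA, of snd] by linarith
  finally show ?thesis .
qed

lemma max_outdeg_pos:
  assumes "simple_digraph VH AH" "AH \<noteq> {}"
  shows "1 \<le> max_outdeg VH AH"
proof -
  have fin: "finite VH" "AH \<subseteq> VH \<times> VH" using assms(1) unfolding simple_digraph_def by auto
  obtain u v where uv: "(u, v) \<in> AH" using assms(2) by auto
  have "finite {w. (u, w) \<in> AH}" by (rule finite_subset[OF _ fin(1)]) (use fin(2) in auto)
  then have "outdeg AH u \<noteq> 0" using uv unfolding outdeg_def by auto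
  moreover have "outdeg AH u \<le> max_outdeg VH AH" unfolding max_outdeg_def using fin uv by (intro Max_ge) auto
  ultimately show ?thesis by linarith
qed

text \<open>As \<open>\<Delta>\<close> is positive, the product raised to the fourth power is at
  least \<open>m\<close>, and \<open>10^7 * m ^ 4\<close> exceeds
  \<open>12000 * m ^ 3\<close>.\<close>

lemma mindeg_numeric:
  fixes m d \<Delta> h :: nat
  assumes "real d \<ge> 10^7 * (real \<Delta> * max (real h / 2) (real m)) ^ 4" "1 \<le> \<Delta>" "1 \<le> m"
  shows "12000 * m ^ 3 \<le> d"
proof -
  have "1 * real m \<le> real \<Delta> * max (real h / 2) (real m)"
    using assms(2) by (intro mult_mono) auto
  then have "real m ^ 4 \<le> (real \<Delta> * max (real h / 2) (real m)) ^ 4" by (intro power_mono) auto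
  then have "10^7 * real m ^ 4 \<le> 10^7 * (real \<Delta> * max (real h / 2) (real m)) ^ 4" by (intro mult_left_mono) auto
  then have 1: "10^7 * real m ^ 4 \<le> real d" using assms(1) by (rule order_trans)
  have "real m ^ 3 \<le> real m ^ 4" using assms(3) by (intro power_increasing) auto
  then have "12000 * real m ^ 3 \<le> real d" using 1 by simp
  then have "real (12000 * m ^ 3) \<le> real d" by simp
  then show ?thesis by (simp only: of_nat_le_iff)
qed

theorem theorem5:
  fixes VH :: "'b set" and AH :: "('b \<times> 'b) set"
    and VD :: "'a set" and AD :: "('a \<times> 'a) set"
  assumes H: "simple_digraph VH AH"
    and degH: "min_total_degree_ge1 VH AH"
    and D: "semicomplete VD AD"
    and conn: "t_connected (num_sources VH AH + card AH + 1) VD AD"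
    and mindeg: "real (min_outdeg VD AD) \<ge> 10^7 *
        (real (max_outdeg VH AH) * max (real (card VH) / 2) (real (card AH))) ^ 4"
  shows "H_linked VH AH VD AD"
  unfolding H_linked_def
proof (intro allI impI, elim conjE)
  fix f :: "'b \<Rightarrow> 'a"
  assume f: "inj_on f VH" "f ` VH \<subseteq> VD"
  define m where "m = card AH"
  have finH: "finite VH" "AH \<subseteq> VH \<times> VH" "\<And>v. (v, v) \<notin> AH" using H unfolding simple_digraph_def by auto
  then have finA: "finite AH" by (meson finite_SigmaI finite_subset)
  have finV: "finite VD" and AD: "AD \<subseteq> VD \<times> VD"
    and total: "\<And>x y. x \<in> VD \<Longrightarrow> y \<in> VD \<Longrightarrow> x \<noteq> y \<Longrightarrow> (x, y) \<in> AD \<or> (y, x) \<in> AD"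
    using D unfolding semicomplete_def simple_digraph_def by blast+
  show "\<exists>g. is_subdivision VH AH VD AD f g"
  proof (cases "AH = {}")
    case True
    then show ?thesis using f unfolding is_subdivision_def by auto
  next
    case False
    then have m: "0 < m" using finA unfolding m_def by auto
    define R where "R = f ` VH"
    define S where "S = f ` {v \<in> VH. indeg AH v = 0}"
    \<comment> \<open>Images of sources are never targets of the linkage, so cuts are considered
      after their deletion.\<close>
    define V' where "V' = VD - S"
    define b where "b = 4 * m"
    have RV: "R \<subseteq> VD" using f(2) unfolding R_def .
    have SR: "S \<subseteq> R" unfolding S_def R_def by auto
    have finR: "finite R" using finH(1) unfolding R_def by auto
    have cR: "card R \<le> 2 * m"
      using card_vertices_le[OF H degH] card_image_le[OF finH(1), of f] unfolding R_def m_def by linarith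
    have m2: "1 \<le> m ^ 2" "m \<le> m ^ 2" using m by (simp_all add: power2_eq_square)
    have d: "12000 * m ^ 3 \<le> min_outdeg VD AD"
      using mindeg_numeric[OF mindeg max_outdeg_pos[OF H False]] m unfolding m_def by simp
    have deg: "\<forall>v\<in>VD. min_outdeg VD AD \<le> card (AD `` {v})"
    proof
      fix v assume that: "v \<in> VD"
      have "min_outdeg VD AD \<le> outdeg AD v" unfolding min_outdeg_def using that finV by (intro Min_le) auto
      moreover have "AD `` {v} = {w. (v, w) \<in> AD}" by auto
      ultimately show "min_outdeg VD AD \<le> card (AD `` {v})" unfolding outdeg_def by simp
    qed
    have VD: "VD \<noteq> {}" using conn[unfolded t_connected_def, THEN conjunct1] by auto
    interpret D: semicomplete_arcs VD AD using finV total by unfold_locales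
    interpret D': semicomplete_arcs V' AD using finV total unfolding V'_def by unfold_locales auto
    obtain X J where X: "X \<subseteq> VD - R" "card X = 20 * m" and J0: "hub_routes AD X (VD - R - X) J"
      and esc: "\<forall>s\<in>VD. \<forall>Z. finite Z \<longrightarrow> card Z \<le> 1310 * m ^ 2 \<longrightarrow> (\<exists>ys. length ys \<le> 2 \<and>
         set ys \<subseteq> weak_vertices (VD - R) AD X m - Z \<and> distinct ys \<and> successively (\<lambda>x y. (x, y) \<in> AD) (s # ys) \<and>
         166 * m ^ 3 \<le> card (AD `` {last (s # ys)} - weak_vertices (VD - R) AD X m - Z))"
      using D.hub_system[OF AD RV cR m deg d VD] by (elim exE conjE) (rule that)
    define W0 where "W0 = weak_vertices (VD - R) AD X m"
    define W where "W = (\<Union>(u, v)\<in>{(u, v) \<in> X \<times> X. u \<noteq> v}. set (J (u, v)))"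
    define \<C> where "\<C> = {(A, B). near_cut V' AD b A B \<and> X \<inter> B = {}}"
    define CW where "CW = {y \<in> W0. \<exists>(A, B)\<in>\<C>. crosses V' AD A B y}"
    \<comment> \<open>The weak stretches and the vertices after them must avoid \<open>Z0\<close>.
      Excluding \<open>CW\<close> ensures that no chosen weak vertex crosses a relevant cut.\<close>
    define Z0 where "Z0 = R \<union> X \<union> W \<union> CW"
    have finX: "finite X" using X(1) finV by (meson finite_Diff finite_subset)
    have W0: "W0 \<subseteq> VD - R - X" "finite W0" using finV unfolding W0_def weak_vertices_def by auto
    have J: "hub_routes AD X W J" and WV: "W \<subseteq> VD - R - X"
    proof -
      show "hub_routes AD X W J" using J0 unfolding hub_routes_def W_def by blast
      show "W \<subseteq> VD - R - X" using J0 unfolding hub_routes_def W_def by blast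
    qed
    have finW: "finite W" using WV finV by (meson finite_Diff finite_subset)
    have cW: "card W \<le> 1200 * m ^ 2"
    proof -
      let ?I = "{(u, v) \<in> X \<times> X. u \<noteq> v}"
      have finI: "finite ?I" by (rule finite_subset[of _ "X \<times> X"]) (use finX in auto)
      have "W = (\<Union>i\<in>?I. set (J i))" unfolding W_def by auto
      moreover have "length (J i) \<le> 3" if "i \<in> ?I" for i using that J0 unfolding hub_routes_def by auto
      ultimately have "card W \<le> 3 * card ?I" using card_UN_set_le[OF finI, of J 3] by simp
      moreover have "card ?I \<le> card (X \<times> X)" using finX by (intro card_mono) auto
      ultimately show ?thesis using X(2) by (simp add: card_cartesian_product power2_eq_square)
    qed
    have cuts: "near_cut V' AD b A B" if "(A, B) \<in> \<C>" for A B using that unfolding \<C>_def by auto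
    \<comment> \<open>A vertex of \<open>B\<close> dominates every hub in \<open>A\<close>, that is,
      all hubs outside a separator of at most \<open>4 * m\<close> vertices. A weak vertex dominates
      fewer than \<open>2 * m\<close> hubs.\<close>
    have W0B: "W0 \<inter> B = {}" if AB: "(A, B) \<in> \<C>" for A B
    proof (rule ccontr)
      assume "W0 \<inter> B \<noteq> {}"
      then obtain y where y: "y \<in> W0" "y \<in> B" by blast
      have XV': "X \<subseteq> V'" using X(1) SR unfolding V'_def by auto
      have nc: "near_cut V' AD b A B" and XB: "X \<inter> B = {}" using AB unfolding \<C>_def by auto
      have "X \<subseteq> (AD `` {y} \<inter> X) \<union> (V' - A - B)"
      proof
        fix x assume x: "x \<in> X"
        have "(y, x) \<in> AD" if "x \<in> A"
        proof -
          have "(x, y) \<notin> AD" using nc that y(2) unfolding near_cut_def by blast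
          then show ?thesis using total[of x y] x y W0(1) X(1) by blast
        qed
        then show "x \<in> (AD `` {y} \<inter> X) \<union> (V' - A - B)" using x XB XV' by blast
      qed
      then have "card X \<le> card ((AD `` {y} \<inter> X) \<union> (V' - A - B))"
        using finX D'.finV by (intro card_mono) auto
      also have "\<dots> \<le> card (AD `` {y} \<inter> X) + card (V' - A - B)" by (rule card_Un_le)
      also have "\<dots> < 2 * m + 4 * m"
        using y(1) nc unfolding W0_def weak_vertices_def near_cut_def b_def by auto
      finally show False using X(2) by linarith
    qed
    have "card CW \<le> b + (2 * (2 * b + b * (2 * b)) + 1)"
      unfolding CW_def by (rule D'.card_crossing_vertices[OF _ W0(2)]) (fact cuts, fact W0B)
    also have "\<dots> = 64 * m ^ 2 + 20 * m + 1" unfolding b_def by (simp add: power2_eq_square algebra_simps)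
    also have "\<dots> \<le> 85 * m ^ 2" using m2 by linarith
    finally have cCW: "card CW \<le> 85 * m ^ 2" .
    have finZ0: "finite Z0" using finR finX finW W0(2) unfolding Z0_def CW_def by auto
    \<comment> \<open>1307 = 2 + 20 + 1200 + 85; raising it to 1310 makes room for the weak
      stretches of the other arcs.\<close>
    have cZ0: "card Z0 \<le> 1307 * m ^ 2"
      using card_Un_le[of "R \<union> X \<union> W" CW] card_Un_le[of "R \<union> X" W] card_Un_le[of R X]
        cR X(2) cW cCW m2 unfolding Z0_def by linarith
    \<comment> \<open>Candidates for the vertex after the weak stretch \<open>l\<close>; an empty
      stretch means leaving directly from \<open>f (fst e)\<close>.\<close>
    define F where "F e l = AD `` {last (f (fst e) # l)} - W0 - Z0" for e :: "'b \<times> 'b" and l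
    have finF: "finite (F e l)" "F e l \<subseteq> VD" for e l
    proof -
      show "F e l \<subseteq> VD" using AD unfolding F_def by auto
      then show "finite (F e l)" using finV finite_subset by auto
    qed
    define Q where "Q e l \<longleftrightarrow> distinct l \<and> set l \<subseteq> W0 - Z0 \<and>
      successively (\<lambda>x y. (x, y) \<in> AD) (f (fst e) # l) \<and> 166 * m ^ 3 \<le> card (F e l)" for e :: "'b \<times> 'b" and l
    have fV: "f (fst e) \<in> R" "f (snd e) \<in> R" "f (fst e) \<noteq> f (snd e)" if "e \<in> AH" for e
    proof -
      have e: "fst e \<in> VH" "snd e \<in> VH" using that finH(2) by auto
      moreover have "fst e \<noteq> snd e" using that finH(3)[of "fst e"] by (metis prod.collapse)
      ultimately show "f (fst e) \<in> R" "f (snd e) \<in> R" "f (fst e) \<noteq> f (snd e)"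
        using inj_onD[OF f(1)] unfolding R_def by blast+
    qed
    have "\<exists>ys. (\<forall>e\<in>AH. Q e (ys e) \<and> length (ys e) \<le> 2) \<and>
      (\<forall>e\<in>AH. \<forall>e'\<in>AH. e \<noteq> e' \<longrightarrow> set (ys e) \<inter> set (ys e') = {})"
    proof (rule greedy_disjoint_lists[OF finA])
      fix e and Z :: "'a set" assume e: "e \<in> AH" and Z: "finite Z" "card Z \<le> 2 * card AH"
      have "card (Z \<union> Z0) \<le> 1310 * m ^ 2"
        using card_Un_le[of Z Z0] Z(2) cZ0 m2 unfolding m_def by linarith
      moreover have "f (fst e) \<in> VD" "finite (Z \<union> Z0)" using fV(1)[OF e] RV Z(1) finZ0 by auto
      ultimately obtain ys where ys: "length ys \<le> 2" "set ys \<subseteq> W0 - (Z \<union> Z0)" "distinct ys"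
        "successively (\<lambda>x y. (x, y) \<in> AD) (f (fst e) # ys)"
        "166 * m ^ 3 \<le> card (AD `` {last (f (fst e) # ys)} - W0 - (Z \<union> Z0))"
        using esc unfolding W0_def by metis
      have "card (AD `` {last (f (fst e) # ys)} - W0 - (Z \<union> Z0)) \<le> card (F e ys)"
        using finF by (intro card_mono) (auto simp: F_def)
      then have "Q e ys" using ys unfolding Q_def by auto
      then show "\<exists>l. Q e l \<and> length l \<le> 2 \<and> set l \<inter> Z = {}" using ys(1,2) by blast
    qed
    then obtain ys where ys: "\<And>e. e \<in> AH \<Longrightarrow> Q e (ys e)" "\<And>e. e \<in> AH \<Longrightarrow> length (ys e) \<le> 2"
      and ysd: "\<And>e e'. e \<in> AH \<Longrightarrow> e' \<in> AH \<Longrightarrow> e \<noteq> e' \<Longrightarrow> set (ys e) \<inter> set (ys e') = {}"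
      by blast
    define conflict where "conflict v w \<longleftrightarrow> (\<exists>(A, B)\<in>\<C>. crosses V' AD A B v \<and> crosses V' AD A B w)" for v w
    have "\<exists>z. (\<forall>e\<in>AH. z e \<in> F e (ys e)) \<and>
      (\<forall>e\<in>AH. \<forall>e'\<in>AH. e \<noteq> e' \<longrightarrow> z e \<noteq> z e' \<and> \<not> conflict (z e) (z e'))"
    \<comment> \<open>The degeneracy bound for \<open>b = 4 * m\<close> is
      \<open>128 * m ^ 2 + 36 * m + 2\<close>, hence 166; one share for each of the \<open>m\<close>
      arcs gives \<open>166 * m ^ 3\<close>.\<close>
    proof (rule independent_transversal[OF finA, where V = UNIV and \<kappa> = "166 * m ^ 2"])
      fix U :: "'a set" assume U: "finite U" "U \<noteq> {}"
      have "b + 2 * (2 * (2 * b + b * (2 * b)) + 1) = 128 * m ^ 2 + 36 * m + 2"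
        unfolding b_def by (simp add: power2_eq_square algebra_simps)
      also have "\<dots> \<le> 166 * m ^ 2" using m2 by linarith
      finally have le: "b + 2 * (2 * (2 * b + b * (2 * b)) + 1) \<le> 166 * m ^ 2" .
      have "\<exists>v\<in>U. card {w \<in> U. w = v \<or> conflict v w} \<le> b + 2 * (2 * (2 * b + b * (2 * b)) + 1)"
        unfolding conflict_def by (rule D'.conflict_degenerate[OF _ U]) (rule cuts)
      then show "\<exists>v\<in>U. card {w \<in> U. w = v \<or> conflict v w} \<le> 166 * m ^ 2"
        using le by (meson le_trans)
    next
      fix e assume e: "e \<in> AH"
      have "166 * m ^ 3 \<le> card (F e (ys e))" using ys(1)[OF e] unfolding Q_def by blast
      moreover have "card AH * (166 * m ^ 2) = 166 * m ^ 3"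
        unfolding m_def[symmetric] by (simp add: power2_eq_square power3_eq_cube)
      moreover have "F e (ys e) \<noteq> {}"
      proof
        assume "F e (ys e) = {}"
        then show False using calculation(1) m by simp
      qed
      ultimately show "finite (F e (ys e)) \<and> F e (ys e) \<subseteq> UNIV \<and> card AH * (166 * m ^ 2) \<le> card (F e (ys e)) \<and> F e (ys e) \<noteq> {}"
        using finF by auto
    qed (auto simp: conflict_def)
    then obtain z where z: "\<And>e. e \<in> AH \<Longrightarrow> z e \<in> F e (ys e)"
      and zd: "\<And>e e'. e \<in> AH \<Longrightarrow> e' \<in> AH \<Longrightarrow> e \<noteq> e' \<Longrightarrow> z e \<noteq> z e' \<and> \<not> conflict (z e) (z e')"
      by blast
    define Y where "Y = (\<Union>e\<in>AH. set (ys e)) \<union> z ` AH"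
    have ysW: "set (ys e) \<subseteq> W0 - Z0" if "e \<in> AH" for e using ys(1)[OF that] unfolding Q_def by blast
    have zF: "z e \<in> VD" "z e \<notin> W0" "z e \<notin> Z0" "(last (f (fst e) # ys e), z e) \<in> AD" if "e \<in> AH" for e
      using z[OF that] AD unfolding F_def by auto
    have YV: "Y \<subseteq> VD - R - X" using ysW zF W0(1) unfolding Y_def Z0_def by blast
    have YW: "Y \<inter> W = {}" using ysW zF(3) unfolding Y_def Z0_def by blast
    have cys: "card (\<Union>e\<in>AH. set (ys e)) \<le> 2 * card AH" using finA ys(2) by (rule card_UN_set_le)
    have cY: "card Y \<le> 3 * card AH"
      using card_Un_le[of "\<Union>e\<in>AH. set (ys e)" "z ` AH"] cys card_image_le[OF finA, of z]
      unfolding Y_def by linarith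
    have "\<exists>P. linkage AD (VD - f ` VH - Y) X AH (\<lambda>e. f (snd e)) P"
    proof (rule linkage_avoiding_scattered[OF finV finH(1,2) f])
      show "t_connected (card {v \<in> VH. indeg AH v = 0} + card AH + 1) VD AD"
        using conn unfolding num_sources_def .
      show "X \<subseteq> VD - f ` VH" "Y \<subseteq> VD - f ` VH - X" using X(1) YV unfolding R_def by auto
      show "card AH \<le> card X" using X(2) unfolding m_def by simp
      show "card Y \<le> 3 * card AH" by (rule cY)
      fix A B y y'
      assume "near_cut (VD - f ` {v \<in> VH. indeg AH v = 0}) AD (4 * card AH) A B" "X \<inter> B = {}"
        and y: "y \<in> Y" "y' \<in> Y"
        and "crosses (VD - f ` {v \<in> VH. indeg AH v = 0}) AD A B y" "crosses (VD - f ` {v \<in> VH. indeg AH v = 0}) AD A B y'"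
      then have AB: "(A, B) \<in> \<C>" and cr: "crosses V' AD A B y" "crosses V' AD A B y'"
        unfolding \<C>_def V'_def S_def b_def m_def by auto
      \<comment> \<open>Since the weak part of \<open>Y\<close> avoids \<open>CW\<close>, only the
        vertices \<open>z e\<close> can cross, and these are conflict-free.\<close>
      have isz: "v \<in> z ` AH" if "v \<in> Y" "crosses V' AD A B v" for v
      proof (rule ccontr)
        assume "v \<notin> z ` AH"
        then have "v \<in> W0 - Z0" using that(1) ysW unfolding Y_def by blast
        moreover from this have "v \<in> CW" using AB that(2) unfolding CW_def by blast
        ultimately show False unfolding Z0_def by blast
      qed
      obtain e e' where ee: "e \<in> AH" "e' \<in> AH" "y = z e" "y' = z e'" using isz y cr by blast
      have "conflict (z e) (z e')" using AB cr ee unfolding conflict_def by blast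
      then show "y = y'" using zd[OF ee(1,2)] ee(3,4) by blast
    qed
    then obtain P0 where P0: "linkage AD (VD - R - Y) X AH (\<lambda>e. f (snd e)) P0" unfolding R_def by blast
    have XU: "X \<subseteq> VD - R - Y" "W \<subseteq> VD - R - Y - X" using X(1) YV WV YW by auto
    obtain P where P: "linkage AD (VD - R - Y) X AH (\<lambda>e. f (snd e)) P"
      and PX: "\<forall>e\<in>AH. set (P e) \<inter> X = {hd (P e)}"
      and PJ: "\<forall>u\<in>X - (\<lambda>e. hd (P e)) ` AH. \<forall>v\<in>X. u \<noteq> v \<longrightarrow> set (J (u, v)) \<inter> (\<Union>e\<in>AH. set (P e)) = {}"
      using linkage_avoiding_routes[OF P0 finA XU J] by (elim exE conjE) (rule that)
    let ?used = "(\<lambda>e. hd (P e)) ` AH"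
    \<comment> \<open>With the empty relation the transversal is simply a choice of distinct
      representatives: \<open>z e\<close> dominates at least \<open>2 * m\<close> hubs, of which at
      most \<open>m\<close> are heads of linkage paths.\<close>
    have "\<exists>h. (\<forall>e\<in>AH. h e \<in> AD `` {z e} \<inter> X - ?used) \<and> (\<forall>e\<in>AH. \<forall>e'\<in>AH. e \<noteq> e' \<longrightarrow> h e \<noteq> h e' \<and> \<not> False)"
    proof (rule independent_transversal[OF finA, where V = UNIV and \<kappa> = 1])
      fix e assume e: "e \<in> AH"
      have "z e \<in> VD - R - X" using YV e unfolding Y_def by blast
      then have "2 * m \<le> card (AD `` {z e} \<inter> X)"
        using zF(2)[OF e] unfolding W0_def weak_vertices_def by auto
      moreover have "card ?used \<le> m" unfolding m_def using finA by (rule card_image_le)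
      ultimately have "m \<le> card (AD `` {z e} \<inter> X - ?used)"
        using diff_card_le_card_Diff[of ?used "AD `` {z e} \<inter> X"] finA by auto
      moreover from this have "AD `` {z e} \<inter> X - ?used \<noteq> {}" using m by (metis card.empty leD)
      ultimately show "finite (AD `` {z e} \<inter> X - ?used) \<and> AD `` {z e} \<inter> X - ?used \<subseteq> UNIV \<and>
        card AH * 1 \<le> card (AD `` {z e} \<inter> X - ?used) \<and> AD `` {z e} \<inter> X - ?used \<noteq> {}"
        using finX unfolding m_def by auto
    next
      fix U :: "'a set" assume U: "finite U" "U \<noteq> {}"
      then obtain v where "v \<in> U" by blast
      then have "{w \<in> U. w = v \<or> False} = {v}" by auto
      then show "\<exists>v\<in>U. card {w \<in> U. w = v \<or> False} \<le> 1" using \<open>v \<in> U\<close> by (intro bexI[of _ v]) auto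
    qed simp
    then obtain h where h: "\<And>e. e \<in> AH \<Longrightarrow> h e \<in> AD `` {z e} \<inter> X - ?used"
      and hd: "\<And>e e'. e \<in> AH \<Longrightarrow> e' \<in> AH \<Longrightarrow> e \<noteq> e' \<Longrightarrow> h e \<noteq> h e'" by blast
    have Pe: "P e \<noteq> []" "distinct (P e)" "set (P e) \<subseteq> VD - R - Y" "successively (\<lambda>x y. (x, y) \<in> AD) (P e)"
      "hd (P e) \<in> X" "(last (P e), f (snd e)) \<in> AD" if "e \<in> AH" for e
      using P that unfolding linkage_def by auto
    have Pd: "set (P e) \<inter> set (P e') = {}" if "e \<in> AH" "e' \<in> AH" "e \<noteq> e'" for e e'
      using P that unfolding linkage_def by blast
    define L where "L e = J (h e, hd (P e))" for e
    have hX: "h e \<in> X" "h e \<notin> ?used" "h e \<noteq> hd (P e)" "(z e, h e) \<in> AD" if "e \<in> AH" for e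
      using h[OF that] that by auto
    have L: "distinct (L e)" "set (L e) \<subseteq> W" "successively (\<lambda>x y. (x, y) \<in> AD) (h e # L e @ [hd (P e)])" if "e \<in> AH" for e
      using J hX(1,3)[OF that] Pe(5)[OF that] unfolding hub_routes_def L_def by blast+
    have Ld: "set (L e) \<inter> set (L e') = {}" if "e \<in> AH" "e' \<in> AH" "e \<noteq> e'" for e e'
    proof -
      have "(h e, hd (P e)) \<noteq> (h e', hd (P e'))" using hd[OF that] by simp
      then show ?thesis
        using J hX(1,3)[OF that(1)] hX(1,3)[OF that(2)] Pe(5)[OF that(1)] Pe(5)[OF that(2)]
        unfolding hub_routes_def L_def by blast
    qed
    have ysY: "set (ys e) \<subseteq> Y" "z e \<in> Y" if "e \<in> AH" for e using that unfolding Y_def by auto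
    have avoidY: "Y \<inter> ({h e} \<union> set (L e) \<union> set (P e)) = {}" if "e \<in> AH" for e
    proof -
      have "h e \<notin> Y" using hX(1)[OF that] YV by auto
      moreover have "Y \<inter> set (L e) = {}" using L(2)[OF that] YW by auto
      moreover have "Y \<inter> set (P e) = {}" using Pe(3)[OF that] by auto
      ultimately show ?thesis by auto
    qed
    have s1: "set (ys e) \<inter> ({z e', h e'} \<union> set (L e') \<union> set (P e')) = {}" if "e \<in> AH" "e' \<in> AH" for e e'
    proof -
      have "z e' \<notin> set (ys e)" using ysW[OF that(1)] zF(2)[OF that(2)] by auto
      then show ?thesis using avoidY[OF that(2)] ysY(1)[OF that(1)] by auto
    qed
    have s2: "{z e} \<inter> ({h e'} \<union> set (L e') \<union> set (P e')) = {}" if "e \<in> AH" "e' \<in> AH" for e e'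
      using avoidY[OF that(2)] ysY(2)[OF that(1)] by auto
    have s3: "{h e} \<inter> (set (L e') \<union> set (P e')) = {}" if "e \<in> AH" "e' \<in> AH" for e e'
    proof -
      have "h e \<notin> set (L e')" using hX(1)[OF that(1)] L(2)[OF that(2)] WV by auto
      moreover have "h e \<noteq> hd (P e')" using hX(2)[OF that(1)] that(2) by auto
      then have "h e \<notin> set (P e')" using hX(1)[OF that(1)] bspec[OF PX that(2)] by auto
      ultimately show ?thesis by simp
    qed
    \<comment> \<open>The route \<open>L e\<close> starts at a hub that heads no linkage path, which
      is the case that the cheapest linkage was chosen for.\<close>
    have s4: "set (L e) \<inter> set (P e') = {}" if "e \<in> AH" "e' \<in> AH" for e e'
    proof -
      have "set (L e) \<inter> (\<Union>e\<in>AH. set (P e)) = {}"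
        using PJ hX(1-3)[OF that(1)] Pe(5)[OF that(1)] unfolding L_def by simp
      then show ?thesis using that(2) by blast
    qed
    \<comment> \<open>In order: the weak stretch, the vertex dominating many hubs, a free hub, the
      route to the head of the linkage path, and that path itself.\<close>
    define mid where "mid e = ys e @ z e # h e # L e @ P e" for e
    have set_mid: "set (mid e) = set (ys e) \<union> ({z e} \<union> ({h e} \<union> (set (L e) \<union> set (P e))))" for e
      unfolding mid_def by auto
    have mid_sub: "set (mid e) \<subseteq> VD - R" if "e \<in> AH" for e
      using ysY[OF that] YV hX(1)[OF that] X(1) L(2)[OF that] WV Pe(3)[OF that] unfolding set_mid by blast
    have mid_distinct: "distinct (mid e)" if e: "e \<in> AH" for e
    proof -
      have "distinct (ys e)" using ys(1)[OF e] unfolding Q_def by blast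
      then show ?thesis
        using s1[OF e e] s2[OF e e] s3[OF e e] s4[OF e e] L(1)[OF e] Pe(2)[OF e] unfolding mid_def by auto
    qed
    have mid_walk: "successively (\<lambda>x y. (x, y) \<in> AD) (f (fst e) # mid e @ [f (snd e)])" if e: "e \<in> AH" for e
    proof -
      let ?w = "successively (\<lambda>x y. (x, y) \<in> AD)"
      have "?w (f (fst e) # ys e)" using ys(1)[OF e] unfolding Q_def by blast
      moreover have "?w (z e # (h e # L e) @ P e @ [f (snd e)])"
      proof -
        have "?w ((h e # L e) @ [hd (P e)])" using L(3)[OF e] by simp
        then have "?w (h e # L e)" "(last (h e # L e), hd (P e)) \<in> AD"
          unfolding successively_append_iff[of _ "h e # L e"] by simp_all
        moreover have "?w (P e @ [f (snd e)])" using Pe(1,4,6)[OF e] by (simp add: successively_append_iff)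
        ultimately have "?w ((h e # L e) @ P e @ [f (snd e)])"
          using Pe(1)[OF e] unfolding successively_append_iff[of _ "h e # L e"] by simp
        then show ?thesis using hX(4)[OF e] by simp
      qed
      ultimately have "?w ((f (fst e) # ys e) @ z e # (h e # L e) @ P e @ [f (snd e)])"
        using zF(4)[OF e] unfolding successively_append_iff[of _ "f (fst e) # ys e"] by simp
      then show ?thesis unfolding mid_def by simp
    qed
    have mid_disjoint: "set (mid e) \<inter> set (mid e') = {}" if e: "e \<in> AH" "e' \<in> AH" "e \<noteq> e'" for e e'
    proof -
      have "z e \<noteq> z e'" "h e \<noteq> h e'" using zd[OF e] hd[OF e] by auto
      then show ?thesis
        using s1[OF e(1,2)] s1[OF e(2,1)] s2[OF e(1,2)] s2[OF e(2,1)] s3[OF e(1,2)] s3[OF e(2,1)]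
          s4[OF e(1,2)] s4[OF e(2,1)] ysd[OF e] Ld[OF e] Pd[OF e]
        unfolding set_mid by auto
    qed
    define g where "g e = f (fst e) # mid e @ [f (snd e)]" for e
    have "is_subdivision VH AH VD AD f g"
      unfolding is_subdivision_def
    proof (intro conjI)
      have "dpath VD AD (g e) (f (fst e)) (f (snd e))" if e: "e \<in> AH" for e
        unfolding g_def
        by (rule dpath_Cons_snoc[OF mid_walk[OF e] mid_distinct[OF e]]) (use mid_sub[OF e] fV[OF e] RV in auto)
      then show "\<forall>(u, v)\<in>AH. dpath VD AD (g (u, v)) (f u) (f v)" by force
      show "\<forall>a\<in>AH. \<forall>b\<in>AH. a \<noteq> b \<longrightarrow> internal (g a) \<inter> internal (g b) = {}"
        using mid_disjoint unfolding g_def internal_Cons_snoc by blast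
      show "\<forall>a\<in>AH. internal (g a) \<inter> f ` VH = {}"
        using mid_sub unfolding g_def internal_Cons_snoc R_def by blast
    qed (use f in auto)
    then show ?thesis by blast
  qed
qed

end
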